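(* Let $\mathfrak{g}$ be a unimodular solvable real Lie algebra. (1) If $\mathfrak{g}$ carries a Vaisman structure, then $\mathfrak{g}$ admits a complete left-symmetric algebra (LSA) structure. (2) If $\mathfrak{g}$ carries a Sasakian structure, then $\mathfrak{g}$ admits a complete LSA structure.
   Context: All Lie algebras are finite-dimensional; unimodular means $\operatorname{tr}(\operatorname{ad}_x)=0$ for all $x$. $d$ denotes the Chevalley–Eilenberg differential (so $d\alpha(x,y)=-\alpha([x,y])$ for a $1$-form). LSA: an LSA structure on a Lie algebra $\mathfrak{a}$ is a bilinear product $(x,y)\mapsto x\cdot y$ on $\mathfrak{a}$ with $[x,y]=x\cdot y-y\cdot x$ and $x\cdot(y\cdot z)-(x\cdot y)\cdot z=y\cdot(x\cdot z)-(y\cdot x)\cdot z$ for all $x,y,z$. It is complete if $\mathrm{Id}+\rho(x)$ is bijective for all $x\in\mathfrak{a}$, where $\rho(x)y=y\cdot x$. Vaisman: a complex structure on $\mathfrak{g}$ is an endomorphism $J$ with $J^2=-\mathrm{Id}$ and $[Jx,Jy]-[x,y]-J([Jx,y]+[x,Jy])=0$. Given a Hermitian inner product, put $\omega(x,y)=\langle Jx,y\rangle$. $(J,\langle\cdot,\cdot\rangle)$ is LCK if there is $\theta\in\mathfrak{g}^*$ (the Lee form) with $d\theta=0$ and $d\omega=\theta\wedge\omega$; it is Vaisman if moreover $\nabla\theta=0$ for the Levi-Civita connection $\nabla$, $\langle\nabla_xy,z\rangle=\frac12(\langle[x,y],z\rangle-\langle[y,z],x\rangle+\langle[z,x],y\rangle)$.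 The Lee form of a Vaisman structure is assumed nonzero. Sasakian: an almost contact metric structure on a Lie algebra is $(\langle\cdot,\cdot\rangle,\phi,\xi,\eta)$, with $\langle\cdot,\cdot\rangle$ an inner product, $\phi$ an endomorphism, $\xi$ a vector and $\eta$ a $1$-form such that $\eta(\xi)=1$, $\phi^2=-\mathrm{Id}+\eta\otimes\xi$, $\langle\phi x,\phi y\rangle=\langle x,y\rangle-\eta(x)\eta(y)$. It is Sasakian if $N_\phi=-d\eta\otimes\xi$, where $N_\phi(x,y)=[\phi x,\phi y]+\phi^2[x,y]-\phi([\phi x,y]+[x,\phi y])$, and $d\eta(x,y)=-\langle\phi x,y\rangle$ for all $x,y$. (This is the paper's convention; it agrees with the convention $d\eta=2\Phi$, $\Phi(x,y)=\langle\phi x,y\rangle$, up to rescaling: replace $\langle\cdot,\cdot\rangle,\phi,\eta,\xi$ by $\frac14\langle\cdot,\cdot\rangle,\phi,-\frac12\eta,-2\xi$.) *)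

theory Defs
  imports "HOL-Analysis.Analysis"
begin

section \<open>Finite-dimensional real Lie algebras\<close>

text \<open>
  A Lie algebra is given by a bracket on a whole type of class \<^class>\<open>real_vector\<close>. The class
  \<^class>\<open>euclidean_space\<close> is avoided since it would provide a distinguished inner product and
  exclude dimension zero.
\<close>

locale fd_lie_algebra =
  fixes bracket :: "'a::real_vector \<Rightarrow> 'a \<Rightarrow> 'a"
  assumes finite_dimensional: "\<exists>B :: 'a set. finite B \<and> span B = UNIV"
    and bilinear_bracket: "bilinear bracket"
    and bracket_self: "bracket x x = 0"
    and jacobi: "bracket x (bracket y z) + bracket y (bracket z x) + bracket z (bracket x y) = 0"

definition lin_trace :: "('a::real_vector \<Rightarrow> 'a) \<Rightarrow> real" where
  "lin_trace f =
    (let B = (SOME B. finite B \<and> independent B \<and> span B = UNIV)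
     in \<Sum>b\<in>B. representation B (f b) b)"

definition unimodular :: "('a::real_vector \<Rightarrow> 'a \<Rightarrow> 'a) \<Rightarrow> bool" where
  "unimodular bracket \<longleftrightarrow> (\<forall>x. lin_trace (\<lambda>y. bracket x y) = 0)"

primrec derived_series :: "('a::real_vector \<Rightarrow> 'a \<Rightarrow> 'a) \<Rightarrow> nat \<Rightarrow> 'a set" where
  "derived_series bracket 0 = UNIV"
| "derived_series bracket (Suc n) =
     span {bracket x y | x y. x \<in> derived_series bracket n \<and> y \<in> derived_series bracket n}"

definition solvable_lie :: "('a::real_vector \<Rightarrow> 'a \<Rightarrow> 'a) \<Rightarrow> bool" where
  "solvable_lie bracket \<longleftrightarrow> (\<exists>n. derived_series bracket n = {0})"


section \<open>Left-symmetric algebra structures\<close>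

definition lsa_structure ::
  "('a::real_vector \<Rightarrow> 'a \<Rightarrow> 'a) \<Rightarrow> ('a \<Rightarrow> 'a \<Rightarrow> 'a) \<Rightarrow> bool" where
  "lsa_structure bracket prd \<longleftrightarrow>
     bilinear prd \<and>
     (\<forall>x y. bracket x y = prd x y - prd y x) \<and>
     (\<forall>x y z. prd x (prd y z) - prd (prd x y) z = prd y (prd x z) - prd (prd y x) z)"

definition complete_lsa :: "('a::real_vector \<Rightarrow> 'a \<Rightarrow> 'a) \<Rightarrow> bool" where
  "complete_lsa prd \<longleftrightarrow> (\<forall>x. bij (\<lambda>y. y + prd y x))"


section \<open>Inner products, Levi-Civita connection, differentials\<close>

definition inner_product :: "('a::real_vector \<Rightarrow> 'a \<Rightarrow> real) \<Rightarrow> bool" where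
  "inner_product ip \<longleftrightarrow>
     bilinear ip \<and> (\<forall>x y. ip x y = ip y x) \<and> (\<forall>x. x \<noteq> 0 \<longrightarrow> ip x x > 0)"

text \<open>The vector is given by the Koszul formula; see \<open>levi_civita_koszul\<close> below for
  its existence and uniqueness.\<close>

definition levi_civita ::
  "('a::real_vector \<Rightarrow> 'a \<Rightarrow> 'a) \<Rightarrow> ('a \<Rightarrow> 'a \<Rightarrow> real) \<Rightarrow> 'a \<Rightarrow> 'a \<Rightarrow> 'a" where
  "levi_civita bracket ip x y =
     (THE v. \<forall>z. ip v z =
        (ip (bracket x y) z - ip (bracket y z) x + ip (bracket z x) y) / 2)"

text \<open>Chevalley--Eilenberg differential on 1-forms and 2-forms, and the wedge product of a
  1-form with a 2-form, all without combinatorial normalisation factors.\<close>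

definition ce_diff1 ::
  "('a::real_vector \<Rightarrow> 'a \<Rightarrow> 'a) \<Rightarrow> ('a \<Rightarrow> real) \<Rightarrow> 'a \<Rightarrow> 'a \<Rightarrow> real" where
  "ce_diff1 bracket \<alpha> x y = - \<alpha> (bracket x y)"

definition ce_diff2 ::
  "('a::real_vector \<Rightarrow> 'a \<Rightarrow> 'a) \<Rightarrow> ('a \<Rightarrow> 'a \<Rightarrow> real) \<Rightarrow> 'a \<Rightarrow> 'a \<Rightarrow> 'a \<Rightarrow> real" where
  "ce_diff2 bracket \<beta> x y z =
     - \<beta> (bracket x y) z - \<beta> (bracket y z) x - \<beta> (bracket z x) y"

definition wedge12 ::
  "('a::real_vector \<Rightarrow> real) \<Rightarrow> ('a \<Rightarrow> 'a \<Rightarrow> real) \<Rightarrow> 'a \<Rightarrow> 'a \<Rightarrow> 'a \<Rightarrow> real" where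
  "wedge12 \<alpha> \<beta> x y z = \<alpha> x * \<beta> y z + \<alpha> y * \<beta> z x + \<alpha> z * \<beta> x y"


section \<open>Vaisman structures\<close>

definition complex_structure ::
  "('a::real_vector \<Rightarrow> 'a \<Rightarrow> 'a) \<Rightarrow> ('a \<Rightarrow> 'a) \<Rightarrow> bool" where
  "complex_structure bracket J \<longleftrightarrow>
     linear J \<and> (\<forall>x. J (J x) = - x) \<and>
     (\<forall>x y. bracket (J x) (J y) - bracket x y - J (bracket (J x) y + bracket x (J y)) = 0)"

definition hermitian_structure ::
  "('a::real_vector \<Rightarrow> 'a \<Rightarrow> 'a) \<Rightarrow> ('a \<Rightarrow> 'a) \<Rightarrow> ('a \<Rightarrow> 'a \<Rightarrow> real) \<Rightarrow> bool" where
  "hermitian_structure bracket J ip \<longleftrightarrow>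
     complex_structure bracket J \<and> inner_product ip \<and> (\<forall>x y. ip (J x) (J y) = ip x y)"

definition fundamental_form ::
  "('a::real_vector \<Rightarrow> 'a) \<Rightarrow> ('a \<Rightarrow> 'a \<Rightarrow> real) \<Rightarrow> 'a \<Rightarrow> 'a \<Rightarrow> real" where
  "fundamental_form J ip x y = ip (J x) y"

definition lck_with_lee_form ::
  "('a::real_vector \<Rightarrow> 'a \<Rightarrow> 'a) \<Rightarrow> ('a \<Rightarrow> 'a) \<Rightarrow> ('a \<Rightarrow> 'a \<Rightarrow> real) \<Rightarrow> ('a \<Rightarrow> real) \<Rightarrow> bool"
  where
  "lck_with_lee_form bracket J ip \<theta> \<longleftrightarrow>
     hermitian_structure bracket J ip \<and> linear \<theta> \<and>
     (\<forall>x y. ce_diff1 bracket \<theta> x y = 0) \<and>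
     (\<forall>x y z. ce_diff2 bracket (fundamental_form J ip) x y z
                = wedge12 \<theta> (fundamental_form J ip) x y z)"

text \<open>On left-invariant objects the condition that \<open>\<theta>\<close> is parallel reads
  \<open>(\<nabla>\<^sub>x \<theta>) y = - \<theta> (\<nabla>\<^sub>x y) = 0\<close>.\<close>

definition vaisman_structure ::
  "('a::real_vector \<Rightarrow> 'a \<Rightarrow> 'a) \<Rightarrow> ('a \<Rightarrow> 'a) \<Rightarrow> ('a \<Rightarrow> 'a \<Rightarrow> real) \<Rightarrow> bool" where
  "vaisman_structure bracket J ip \<longleftrightarrow>
     (\<exists>\<theta>. lck_with_lee_form bracket J ip \<theta> \<and> (\<exists>x. \<theta> x \<noteq> 0) \<and>
          (\<forall>x y. - \<theta> (levi_civita bracket ip x y) = 0))"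


section \<open>Sasakian structures\<close>

definition almost_contact_metric ::
  "('a::real_vector \<Rightarrow> 'a \<Rightarrow> real) \<Rightarrow> ('a \<Rightarrow> 'a) \<Rightarrow> 'a \<Rightarrow> ('a \<Rightarrow> real) \<Rightarrow> bool" where
  "almost_contact_metric ip \<phi> \<xi> \<eta> \<longleftrightarrow>
     inner_product ip \<and> linear \<phi> \<and> linear \<eta> \<and> \<eta> \<xi> = 1 \<and>
     (\<forall>x. \<phi> (\<phi> x) = - x + \<eta> x *\<^sub>R \<xi>) \<and>
     (\<forall>x y. ip (\<phi> x) (\<phi> y) = ip x y - \<eta> x * \<eta> y)"

definition nijenhuis_phi ::
  "('a::real_vector \<Rightarrow> 'a \<Rightarrow> 'a) \<Rightarrow> ('a \<Rightarrow> 'a) \<Rightarrow> 'a \<Rightarrow> 'a \<Rightarrow> 'a" where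
  "nijenhuis_phi bracket \<phi> x y =
     bracket (\<phi> x) (\<phi> y) + \<phi> (\<phi> (bracket x y)) - \<phi> (bracket (\<phi> x) y + bracket x (\<phi> y))"

text \<open>The normalisation is \<open>d \<eta> (x, y) = - \<langle>\<phi> x, y\<rangle>\<close>; it differs from the usual
  \<open>d \<eta> = 2 \<Phi>\<close> only by a rescaling of the structure.\<close>

definition sasakian_structure ::
  "('a::real_vector \<Rightarrow> 'a \<Rightarrow> 'a) \<Rightarrow> ('a \<Rightarrow> 'a \<Rightarrow> real) \<Rightarrow> ('a \<Rightarrow> 'a) \<Rightarrow> 'a \<Rightarrow> ('a \<Rightarrow> real) \<Rightarrow> bool"
  where
  "sasakian_structure bracket ip \<phi> \<xi> \<eta> \<longleftrightarrow>
     almost_contact_metric ip \<phi> \<xi> \<eta> \<and>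
     (\<forall>x y. nijenhuis_phi bracket \<phi> x y = - (ce_diff1 bracket \<eta> x y *\<^sub>R \<xi>)) \<and>
     (\<forall>x y. ce_diff1 bracket \<eta> x y = - ip (\<phi> x) y)"


section \<open>Well-definedness\<close>

lemma finite_basis_exists:
  fixes S :: "'a::real_vector set"
  assumes "finite S" and "span S = UNIV"
  obtains B :: "'a set" where "finite B" "independent B" "span B = UNIV"
proof -
  obtain B where "B \<subseteq> S" "independent B" "S \<subseteq> span B"
    using maximal_independent_subset by blast
  moreover have "span B = UNIV"
    using \<open>S \<subseteq> span B\<close> assms(2) span_minimal[of S "span B"] by auto
  ultimately show thesis
    using that finite_subset assms(1) by blast
qed

lemma lin_trace_eq:
  fixes f :: "'a::real_vector \<Rightarrow> 'a"
  assumes lf: "linear f" and C: "finite C" "independent C" "span C = UNIV"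
  shows "lin_trace f = (\<Sum>c\<in>C. representation C (f c) c)"
proof -
  define B where "B = (SOME B :: 'a set. finite B \<and> independent B \<and> span B = UNIV)"
  have B: "finite B" "independent B" "span B = UNIV"
    using someI[of "\<lambda>B :: 'a set. finite B \<and> independent B \<and> span B = UNIV" C] C
    unfolding B_def by auto
  have lin: "linear (\<lambda>v. representation A v a)"
    if "independent A" "span A = UNIV" for A :: "'a set" and a
    using that by (simp add: linear_iff representation_add representation_scale)
  have expand: "(\<Sum>a\<in>A. representation A v a *\<^sub>R a) = v"
    if "finite A" "independent A" "span A = UNIV" for A :: "'a set" and v
    using that sum_representation_eq[of A v A] by auto
  have "(\<Sum>b\<in>B. representation B (f b) b)
      = (\<Sum>b\<in>B. \<Sum>c\<in>C. representation C (f b) c * representation B c b)"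
  proof (rule sum.cong[OF refl])
    fix b assume "b \<in> B"
    have "representation B (f b) b = representation B (\<Sum>c\<in>C. representation C (f b) c *\<^sub>R c) b"
      using expand[OF C] by simp
    also have "\<dots> = (\<Sum>c\<in>C. representation C (f b) c * representation B c b)"
      by (simp add: linear_sum[OF lin[OF B(2,3)]] linear_cmul[OF lin[OF B(2,3)]])
    finally show "representation B (f b) b
      = (\<Sum>c\<in>C. representation C (f b) c * representation B c b)" .
  qed
  also have "\<dots> = (\<Sum>c\<in>C. \<Sum>b\<in>B. representation C (f b) c * representation B c b)"
    by (rule sum.swap)
  also have "\<dots> = (\<Sum>c\<in>C. representation C (f c) c)"
  proof (rule sum.cong[OF refl])
    fix c assume "c \<in> C"
    have "representation C (f c) c = representation C (f (\<Sum>b\<in>B. representation B c b *\<^sub>R b)) c"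
      using expand[OF B] by simp
    also have "\<dots> = (\<Sum>b\<in>B. representation C (f b) c * representation B c b)"
      by (simp add: linear_sum[OF lf] linear_cmul[OF lf] linear_sum[OF lin[OF C(2,3)]]
          linear_cmul[OF lin[OF C(2,3)]] mult.commute)
    finally show "(\<Sum>b\<in>B. representation C (f b) c * representation B c b)
      = representation C (f c) c" ..
  qed
  finally show ?thesis
    unfolding lin_trace_def Let_def B_def .
qed

lemma inner_product_riesz:
  fixes ip :: "'a::real_vector \<Rightarrow> 'a \<Rightarrow> real"
  assumes fin: "\<exists>B :: 'a set. finite B \<and> span B = UNIV"
    and ip: "inner_product ip" and lf: "linear f"
  shows "\<exists>!v. \<forall>z. ip v z = f z"
proof -
  obtain B :: "'a set" where B: "finite B" "independent B" "span B = UNIV"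
    using fin finite_basis_exists by metis
  interpret fd: finite_dimensional_vector_space "scaleR :: real \<Rightarrow> 'a \<Rightarrow> 'a" B
    using B by unfold_locales (auto simp: dependent_raw_def span_raw_def)
  have bil: "bilinear ip" and pos: "\<And>x. x \<noteq> 0 \<Longrightarrow> ip x x > 0"
    using ip by (auto simp: inner_product_def)
  have lin: "linear (ip v)" for v
    using bil by (simp add: bilinear_def)
  have nondeg: "v = w" if "\<And>z. ip v z = ip w z" for v w
    using pos[of "v - w"] that[of "v - w"] bilinear_lsub[OF bil, of v w "v - w"] by force
  have ext: "(\<forall>z. g z = h z) \<longleftrightarrow> (\<forall>b\<in>B. g b = h b)"
    if "linear g" "linear h" for g h :: "'a \<Rightarrow> real"
    using linear_eq_on[OF that, of _ B] B(3) by auto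
  define T where "T v = (\<Sum>b\<in>B. ip v b *\<^sub>R b)" for v
  have "linear T"
    by (simp add: linear_iff T_def bilinear_ladd[OF bil] bilinear_lmul[OF bil]
        scaleR_left_distrib sum.distrib scaleR_sum_right)
  have coeff: "g b = h b" if "(\<Sum>b\<in>B. g b *\<^sub>R b) = (\<Sum>b\<in>B. h b *\<^sub>R b)" "b \<in> B"
    for g h :: "'a \<Rightarrow> real" and b
  proof -
    have "(\<Sum>b\<in>B. (g b - h b) *\<^sub>R b) = 0"
      using that(1) by (simp add: scaleR_left_diff_distrib sum_subtractf)
    then show ?thesis
      using independentD[OF B(2,1) subset_refl _ that(2), of "\<lambda>b. g b - h b"] by simp
  qed
  have "inj T"
  proof (rule injI)
    fix v w assume "T v = T w"
    then have "\<forall>b\<in>B. ip v b = ip w b"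
      using coeff[of "ip v" "ip w"] unfolding T_def by blast
    then show "v = w"
      using ext[OF lin lin] nondeg by blast
  qed
  then have "surj T"
    using fd.linear_inj_imp_surj \<open>linear T\<close> by (simp add: linear_def)
  then obtain v where "T v = (\<Sum>b\<in>B. f b *\<^sub>R b)"
    by (metis surjD)
  then have "\<forall>b\<in>B. ip v b = f b"
    using coeff[of "ip v" f] unfolding T_def by blast
  then have "\<forall>z. ip v z = f z"
    using ext[OF lin lf] by blast
  then show ?thesis
    using nondeg by (metis (full_types))
qed

lemma (in fd_lie_algebra) levi_civita_koszul:
  assumes "inner_product ip"
  shows "ip (levi_civita bracket ip x y) z =
    (ip (bracket x y) z - ip (bracket y z) x + ip (bracket z x) y) / 2"
proof -
  have bil: "bilinear ip"
    using assms by (simp add: inner_product_def)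
  have "linear (\<lambda>z. (ip (bracket x y) z - ip (bracket y z) x + ip (bracket z x) y) / 2)"
    by (simp add: linear_iff bilinear_ladd[OF bil] bilinear_radd[OF bil] bilinear_lmul[OF bil]
        bilinear_rmul[OF bil] bilinear_ladd[OF bilinear_bracket] bilinear_radd[OF bilinear_bracket]
        bilinear_lmul[OF bilinear_bracket] bilinear_rmul[OF bilinear_bracket] algebra_simps
        add_divide_distrib diff_divide_distrib)
  from theI'[OF inner_product_riesz[OF finite_dimensional assms this]]
  show ?thesis
    unfolding levi_civita_def by blast
qed

end

theory Submission
  imports Defs
begin

text \<open>
  In both cases \<open>[x, y] = br x y + \<langle>\<phi> x, y\<rangle> \<xi>\<close>, where \<open>br\<close> is the part of the bracket in the image
  of \<open>\<phi>\<close>. Unimodularity writes \<open>\<xi>\<close> as a sum of brackets, so by Cartan's criterion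
  \<open>tr (ad\<^sub>\<xi>\<^sup>2) = 0\<close>; as \<open>ad\<^sub>\<xi>\<close> is skew, \<open>\<xi>\<close> is central, and \<open>br\<close> is a Lie bracket whose
  Levi-Civita connection \<open>\<nabla>\<close> commutes with \<open>\<phi>\<close>. Its Ricci form is exact, so by unimodularity the
  scalar curvature vanishes. With Cartan's criterion, this expresses a sum of squares as zero and
  shows that the derived algebra of \<open>br\<close> and its orthogonal complement are abelian and that the
  complement acts by skew maps. Hence \<open>\<nabla>\<close> is flat, and \<open>x \<cdot> y = \<nabla>\<^sub>x y + \<langle>\<phi> x, y\<rangle> \<xi> / 2\<close> is a complete
  left-symmetric product.
\<close>

section \<open>Orthonormal bases\<close>

text \<open>On a unimodular metric Lie algebra the scalar curvature is -1/4 times the sum of all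
  |[e, f]|^2 minus 1/2 times the sum of all tr (ad e)^2. Under Cartan's criterion this is
  nonpositive, and zero only for a flat metric; hence a single number decides the curvature.
  Exactness of the Ricci form makes that number vanish because its contraction with
  \<open>\<phi>\<close> evaluates a 1-form on the sum of all [e, \<open>\<phi>\<close> e], which is
  0.

  The given bracket is the central extension of \<open>br\<close> by the 2-cocycle
  <\<open>\<phi>\<close> x, y>. The flat connection of \<open>br\<close> lifts to a left-symmetric
  product of the extension because the cocycle is parallel; the factor 1/2 is due to x . y - y . x
  counting the alternating cocycle twice.

  In Cartan's criterion the real scalars are the obstacle: Lie's theorem rests on eigenvectors.
  Their place is taken by kernels of commutators, which are nonzero for reasons of trace. Quotients
  never leave the given space: they become orthogonal complements or a modified bracket.\<close>

locale fd_inner_product =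
  fixes ip :: "'a::real_vector \<Rightarrow> 'a \<Rightarrow> real"
  assumes fin_dim: "\<exists>B :: 'a set. finite B \<and> span B = UNIV"
    and inner_product: "inner_product ip"
begin

lemma bilinear_ip: "bilinear ip"
  using inner_product by (simp add: inner_product_def)

lemma ip_commute: "ip x y = ip y x"
  using inner_product by (simp add: inner_product_def)

lemma ip_pos: "x \<noteq> 0 \<Longrightarrow> ip x x > 0"
  using inner_product by (simp add: inner_product_def)

lemmas ip_simps =
  bilinear_ladd[OF bilinear_ip] bilinear_radd[OF bilinear_ip]
  bilinear_lsub[OF bilinear_ip] bilinear_rsub[OF bilinear_ip]
  bilinear_lneg[OF bilinear_ip] bilinear_rneg[OF bilinear_ip]
  bilinear_lmul[OF bilinear_ip] bilinear_rmul[OF bilinear_ip]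
  bilinear_lzero[OF bilinear_ip] bilinear_rzero[OF bilinear_ip]

lemma linear_ip_left: "linear (\<lambda>x. ip x y)"
  by (simp add: linear_iff ip_simps)

lemma linear_ip_right: "linear (ip x)"
  by (simp add: linear_iff ip_simps)

lemma ip_sum_left: "ip (\<Sum>i\<in>I. f i) y = (\<Sum>i\<in>I. ip (f i) y)"
  by (rule linear_sum[OF linear_ip_left])

lemma ip_sum_right: "ip x (\<Sum>i\<in>I. f i) = (\<Sum>i\<in>I. ip x (f i))"
  by (rule linear_sum[OF linear_ip_right])

lemma ip_nonneg: "ip x x \<ge> 0"
  using ip_pos[of x] by (cases "x = 0") (auto simp: ip_simps)

lemma ip_self_eq_0: "ip x x = 0 \<longleftrightarrow> x = 0"
  using ip_pos[of x] by (cases "x = 0") (auto simp: ip_simps)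

lemma ip_eqI: "(\<And>z. ip x z = ip y z) \<Longrightarrow> x = y"
  using ip_self_eq_0[of "x - y"] by (simp add: ip_simps)

definition orthonormal :: "'a set \<Rightarrow> bool" where
  "orthonormal E \<longleftrightarrow> finite E \<and> (\<forall>e\<in>E. \<forall>f\<in>E. ip e f = (if e = f then 1 else 0))"

text \<open>Relative to a subspace, so that the trace of a map restricted to an invariant subspace
  is a sum over \<open>E\<close>.\<close>

definition onb :: "'a set \<Rightarrow> 'a set \<Rightarrow> bool" where
  "onb E S \<longleftrightarrow> orthonormal E \<and> span E = S"

lemma orthonormal_coeff:
  assumes "orthonormal E" "e \<in> E"
  shows "ip (\<Sum>f\<in>E. c f *\<^sub>R f) e = c e"
proof -
  have "ip (\<Sum>f\<in>E. c f *\<^sub>R f) e = (\<Sum>f\<in>E. if f = e then c f else 0)"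
    unfolding ip_sum_left
    by (rule sum.cong[OF refl]) (use assms in \<open>auto simp: ip_simps orthonormal_def\<close>)
  also have "\<dots> = c e"
    using assms by (simp add: orthonormal_def)
  finally show ?thesis .
qed

lemma orthonormal_independent:
  assumes "orthonormal E"
  shows "independent E"
proof (rule independent_if_scalars_zero)
  show "finite E" using assms by (simp add: orthonormal_def)
  fix c e assume "(\<Sum>f\<in>E. c f *\<^sub>R f) = 0" "e \<in> E"
  then show "c e = 0"
    using orthonormal_coeff[OF assms, of e c] by (simp add: ip_simps)
qed

lemma onb_expand:
  assumes "onb E S" "x \<in> S"
  shows "(\<Sum>e\<in>E. ip x e *\<^sub>R e) = x"
proof -
  have E: "orthonormal E" "finite E" "x \<in> span E"
    using assms by (auto simp: onb_def orthonormal_def)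
  then obtain c where c: "x = (\<Sum>e\<in>E. c e *\<^sub>R e)"
    by (auto simp: span_finite)
  then show ?thesis
    using orthonormal_coeff[OF E(1)] by (simp cong: sum.cong)
qed

lemma onb_parseval:
  assumes "onb E S" "x \<in> S"
  shows "(\<Sum>e\<in>E. ip x e * ip y e) = ip x y"
proof -
  have "ip x y = ip (\<Sum>e\<in>E. ip x e *\<^sub>R e) y"
    using onb_expand[OF assms] by simp
  also have "\<dots> = (\<Sum>e\<in>E. ip x e * ip y e)"
    by (simp add: ip_sum_left ip_simps ip_commute[of y])
  finally show ?thesis ..
qed

text \<open>Independence bounds the cardinality of orthonormal sets. A largest one between
  \<open>F\<close> and \<open>S\<close> spans \<open>S\<close>, since otherwise a normalised
  Gram-Schmidt remainder could be added.\<close>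

lemma onb_extend:
  assumes S: "subspace S" and F: "orthonormal F" "F \<subseteq> S"
  obtains E where "F \<subseteq> E" "onb E S"
proof -
  obtain B :: "'a set" where B: "finite B" "span B = UNIV"
    using fin_dim by blast
  define Q where "Q E \<longleftrightarrow> F \<subseteq> E \<and> E \<subseteq> S \<and> orthonormal E" for E
  have "card E < Suc (card B)" if "Q E" for E
    using independent_span_bound[OF B(1) orthonormal_independent, of E] that B(2)
    by (auto simp: Q_def)
  moreover have "Q F"
    using F by (simp add: Q_def)
  ultimately obtain E where E: "Q E" and max: "\<And>E'. Q E' \<Longrightarrow> card E' \<le> card E"
    using ex_has_greatest_nat[of Q F card] by (metis less_imp_le_nat)
  have fin: "finite E" and on: "orthonormal E"
    using E by (auto simp: Q_def orthonormal_def)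
  have "x \<in> span E" if x: "x \<in> S" for x
  proof (rule ccontr)
    assume nx: "x \<notin> span E"
    define p where "p = (\<Sum>e\<in>E. ip x e *\<^sub>R e)"
    define r where "r = x - p"
    have pE: "p \<in> span E"
      unfolding p_def by (intro span_sum span_scale span_base)
    have r0: "r \<noteq> 0"
      using nx pE by (auto simp: r_def)
    have "p \<in> S"
      using pE E S span_minimal[of E S] by (auto simp: Q_def)
    then have rS: "r \<in> S"
      using x S by (simp add: r_def subspace_diff)
    have re: "ip r e = 0" if "e \<in> E" for e
      using orthonormal_coeff[OF on that, of "ip x"] by (simp add: r_def p_def ip_simps)
    define u where "u = (1 / sqrt (ip r r)) *\<^sub>R r"
    have uu: "ip u u = 1"
      using ip_pos[OF r0] by (simp add: u_def ip_simps)
    have ue: "ip u e = 0" "ip e u = 0" if "e \<in> E" for e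
      using re[OF that] by (auto simp: u_def ip_simps ip_commute[of e])
    have "u \<notin> E"
      using ue uu by force
    moreover have "Q (insert u E)"
      using E rS S uu ue fin by (auto simp: Q_def orthonormal_def u_def subspace_scale)
    ultimately show False
      using max[of "insert u E"] fin by simp
  qed
  moreover have "span E \<subseteq> S"
    using E S span_minimal by (auto simp: Q_def)
  ultimately have "onb E S"
    using on by (auto simp: onb_def)
  then show thesis
    using that E by (auto simp: Q_def)
qed

lemma onb_exists:
  assumes "subspace S"
  obtains E where "onb E S"
  using onb_extend[OF assms, of "{}"] by (auto simp: orthonormal_def)

lemma onb_card: "onb E S \<Longrightarrow> dim S = card E"
  by (rule dim_eq_card) (auto simp: onb_def orthonormal_independent span_span)

section \<open>Traces and contractions in orthonormal bases\<close>

lemma lin_trace_onb: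
  assumes "linear f" "onb E UNIV"
  shows "lin_trace f = (\<Sum>e\<in>E. ip (f e) e)"
proof -
  have on: "orthonormal E" and E: "finite E" "independent E" "span E = UNIV"
    using assms(2) orthonormal_independent by (auto simp: onb_def orthonormal_def)
  have "representation E x e = ip x e" if "e \<in> E" for x e
    using orthonormal_coeff[OF on that, of "representation E x"]
      sum_representation_eq[of E x E] E by simp
  then show ?thesis
    using lin_trace_eq[OF assms(1) E] by simp
qed

lemma trace_commute:
  assumes E: "onb E S"
    and f: "linear f" "\<And>v. v \<in> S \<Longrightarrow> f v \<in> S" and g: "linear g" "\<And>v. v \<in> S \<Longrightarrow> g v \<in> S"
  shows "(\<Sum>e\<in>E. ip (f (g e)) e) = (\<Sum>e\<in>E. ip (g (f e)) e)"
proof -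
  have ES: "e \<in> S" if "e \<in> E" for e
    using E that span_base by (auto simp: onb_def)
  have expand: "ip (h (k e)) e = (\<Sum>d\<in>E. ip (k e) d * ip (h d) e)"
    if "linear h" "k e \<in> S" for h k :: "'a \<Rightarrow> 'a" and e
  proof -
    have "ip (h (k e)) e = ip (h (\<Sum>d\<in>E. ip (k e) d *\<^sub>R d)) e"
      using onb_expand[OF E that(2)] by simp
    then show ?thesis
      by (simp add: linear_sum[OF that(1)] linear_cmul[OF that(1)] ip_sum_left ip_simps)
  qed
  have "(\<Sum>e\<in>E. ip (f (g e)) e) = (\<Sum>e\<in>E. \<Sum>d\<in>E. ip (g e) d * ip (f d) e)"
    using expand[OF f(1), of g] g(2) ES by (simp cong: sum.cong)
  also have "\<dots> = (\<Sum>d\<in>E. \<Sum>e\<in>E. ip (f d) e * ip (g e) d)"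
    by (subst sum.swap) (simp add: mult.commute)
  also have "\<dots> = (\<Sum>e\<in>E. ip (g (f e)) e)"
    using expand[OF g(1), of f] f(2) ES by (simp cong: sum.cong)
  finally show ?thesis .
qed

text \<open>The tensor sum of all e \<otimes> e is inverse to the inner product, so a map on the
  first factor equals its adjoint on the second.\<close>

lemma sum_onb_adjoint:
  fixes b :: "'a \<Rightarrow> 'a \<Rightarrow> 'c::real_vector"
  assumes E: "onb E UNIV" and b: "bilinear b" and adj: "\<And>x y. ip (f x) y = ip x (g y)"
  shows "(\<Sum>e\<in>E. b (f e) e) = (\<Sum>e\<in>E. b e (g e))"
proof -
  have "(\<Sum>e\<in>E. b (f e) e) = (\<Sum>e\<in>E. \<Sum>d\<in>E. ip (f e) d *\<^sub>R b d e)"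
  proof (rule sum.cong[OF refl])
    fix e
    have "b (f e) e = b (\<Sum>d\<in>E. ip (f e) d *\<^sub>R d) e"
      using onb_expand[OF E] by simp
    also have "\<dots> = (\<Sum>d\<in>E. ip (f e) d *\<^sub>R b d e)"
      using b by (simp add: linear_sum[of "\<lambda>x. b x e"] bilinear_def linear_cmul[of "\<lambda>x. b x e"])
    finally show "b (f e) e = (\<Sum>d\<in>E. ip (f e) d *\<^sub>R b d e)" .
  qed
  also have "\<dots> = (\<Sum>d\<in>E. \<Sum>e\<in>E. ip (g d) e *\<^sub>R b d e)"
    by (subst sum.swap) (simp add: adj ip_commute[of "g _"])
  also have "\<dots> = (\<Sum>d\<in>E. b d (g d))"
  proof (rule sum.cong[OF refl])
    fix d
    have "b d (g d) = b d (\<Sum>e\<in>E. ip (g d) e *\<^sub>R e)"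
      using onb_expand[OF E] by simp
    also have "\<dots> = (\<Sum>e\<in>E. ip (g d) e *\<^sub>R b d e)"
      using b by (simp add: linear_sum[of "b d"] bilinear_def linear_cmul[of "b d"])
    finally show "(\<Sum>e\<in>E. ip (g d) e *\<^sub>R b d e) = b d (g d)" ..
  qed
  finally show ?thesis .
qed

lemma sum_onb_skew:
  fixes b :: "'a \<Rightarrow> 'a \<Rightarrow> 'c::real_vector"
  assumes "onb E UNIV" "bilinear b" "\<And>x y. ip (f x) y = - ip x (f y)"
  shows "(\<Sum>e\<in>E. b (f e) e) = - (\<Sum>e\<in>E. b e (f e))"
  using sum_onb_adjoint[OF assms(1,2), of f "\<lambda>x. - f x"] assms(3)
  by (simp add: ip_simps bilinear_rneg[OF assms(2)] sum_negf)

section \<open>Minimal subspaces and singular commutators\<close>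

lemma subspace_eq_if_dim_le:
  fixes S T :: "'a set"
  assumes "subspace S" "subspace T" "S \<subseteq> T" "dim T \<le> dim S"
  shows "S = T"
proof -
  obtain F where F: "onb F S" using onb_exists[OF assms(1)] by blast
  have "orthonormal F" "F \<subseteq> T"
    using F assms(3) span_superset[of F] by (auto simp: onb_def)
  then obtain E where E: "F \<subseteq> E" "onb E T"
    using onb_extend[OF assms(2)] by blast
  have "finite E" using E by (auto simp: onb_def orthonormal_def)
  then have "F = E"
    using E F assms(4) onb_card by (metis card_seteq)
  then show ?thesis using E F by (simp add: onb_def)
qed

lemma minimal_subspace:
  fixes S :: "'a set"
  assumes "subspace S" "S \<noteq> {0}" "Q S"
  obtains W where "subspace W" "W \<subseteq> S" "W \<noteq> {0}" "Q W"
    "\<And>U. subspace U \<Longrightarrow> U \<subseteq> W \<Longrightarrow> U \<noteq> {0} \<Longrightarrow> Q U \<Longrightarrow> U = W"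
proof -
  define R where "R W \<longleftrightarrow> subspace W \<and> W \<subseteq> S \<and> W \<noteq> {0} \<and> Q W" for W
  obtain W where "R W" "\<And>U. R U \<Longrightarrow> dim W \<le> dim U"
    using ex_has_least_nat[of R S dim] assms by (auto simp: R_def)
  then show thesis
    using that[of W] subspace_eq_if_dim_le[of _ W] unfolding R_def
    by (metis (no_types, lifting) subset_trans)
qed

lemma linear_inj_on_surj:
  fixes f :: "'a \<Rightarrow> 'a" and W :: "'a set"
  assumes f: "linear f" and W: "subspace W" "\<And>v. v \<in> W \<Longrightarrow> f v \<in> W"
    and inj: "\<And>v. v \<in> W \<Longrightarrow> f v = 0 \<Longrightarrow> v = 0"
  shows "f ` W = W"
proof -
  obtain E where E: "onb E W" using onb_exists[OF W(1)] by blast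
  have ind: "independent E" and sp: "span E = W"
    using E orthonormal_independent by (auto simp: onb_def)
  have "inj_on f W"
    using linear_inj_on_iff_eq_0[OF f W(1)] inj by blast
  then have fE: "independent (f ` E)" and "card (f ` E) = card E"
    using linear_independent_injective_image[OF f ind] sp span_superset[of E] 
    by (auto intro: card_image inj_on_subset)
  moreover have "span (f ` E) = f ` W"
    using linear_span_image[OF f] sp by metis
  ultimately have "dim (f ` W) = dim W"
    using dim_span_eq_card_independent ind sp by metis
  then show ?thesis
    using subspace_eq_if_dim_le[of "f ` W" W] W linear_subspace_image[OF f] by auto
qed

text \<open>If \<open>C\<close> were injective, then \<open>[A C\<^sup>-\<^sup>1, B]\<close> would be the identity of \<open>W\<close>, whose trace is not 0.\<close>

lemma commutator_not_injective:
  fixes A B C :: "'a \<Rightarrow> 'a" and W :: "'a set"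
  assumes W: "subspace W" "W \<noteq> {0}"
    and lin: "linear A" "linear B" "linear C"
    and inv: "\<And>v. v \<in> W \<Longrightarrow> A v \<in> W" "\<And>v. v \<in> W \<Longrightarrow> B v \<in> W" "\<And>v. v \<in> W \<Longrightarrow> C v \<in> W"
    and comm: "\<And>v. v \<in> W \<Longrightarrow> C v = A (B v) - B (A v)"
      "\<And>v. v \<in> W \<Longrightarrow> C (B v) = B (C v)"
  shows "\<exists>v\<in>W. v \<noteq> 0 \<and> C v = 0"
proof (rule ccontr)
  assume "\<not> ?thesis"
  then have ker: "\<And>v. v \<in> W \<Longrightarrow> C v = 0 \<Longrightarrow> v = 0" by blast
  have surj: "C ` W = W"
    by (rule linear_inj_on_surj[OF lin(3) W(1) inv(3) ker])
  have "inj_on C W"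
    using linear_inj_on_iff_eq_0[OF lin(3) W(1)] ker by blast
  then obtain G where G: "range G \<subseteq> W" "linear G" "\<And>v. v \<in> W \<Longrightarrow> G (C v) = v"
    using linear_exists_left_inverse_on[OF lin(3) W(1)] by blast
  have CG: "C (G w) = w" if "w \<in> W" for w
    using that surj G(3) by (metis imageE)
  have BG: "B (G w) = G (B w)" if "w \<in> W" for w
    using that surj G(3) comm(2) inv(2) by (metis (no_types, lifting) imageE)
  obtain E where E: "onb E W" using onb_exists[OF W(1)] by blast
  have EW: "e \<in> W" if "e \<in> E" for e
    using E that span_base by (auto simp: onb_def)
  have GW: "G w \<in> W" for w using G(1) by blast
  \<comment> \<open>\<open>G\<close> inverts \<open>C\<close> on \<open>W\<close> and commutes with
    \<open>B\<close>, so A G B - B A G = (A B - B A) G = C G is the identity.\<close>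
  have ident: "ip (A (G (B e))) e - ip (B (A (G e))) e = 1" if "e \<in> E" for e
  proof -
    have "A (G (B e)) - B (A (G e)) = e"
      using BG[OF EW[OF that]] comm(1)[OF GW, of e] CG[OF EW[OF that]] by simp
    then show ?thesis
      using E that by (auto simp: onb_def orthonormal_def simp flip: ip_simps(3))
  qed
  have "(\<Sum>e\<in>E. ip (A (G (B e))) e) = (\<Sum>e\<in>E. ip (B (A (G e))) e)"
    using trace_commute[OF E linear_compose[OF G(2) lin(1)] _ lin(2) inv(2)] GW inv(1) by simp
  then have "(\<Sum>e\<in>E. ip (A (G (B e))) e - ip (B (A (G e))) e) = 0"
    by (simp add: sum_subtractf)
  then have "card E = 0"
    using ident by simp
  then have "W = {0}"
    using E by (auto simp: onb_def orthonormal_def)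
  then show False using W(2) by simp
qed

end

section \<open>Cartan's criterion\<close>

context fd_lie_algebra
begin

lemmas bracket_simps =
  bilinear_ladd[OF bilinear_bracket] bilinear_radd[OF bilinear_bracket]
  bilinear_lsub[OF bilinear_bracket] bilinear_rsub[OF bilinear_bracket]
  bilinear_lneg[OF bilinear_bracket] bilinear_rneg[OF bilinear_bracket]
  bilinear_lmul[OF bilinear_bracket] bilinear_rmul[OF bilinear_bracket]
  bilinear_lzero[OF bilinear_bracket] bilinear_rzero[OF bilinear_bracket]

lemma linear_bracket_left: "linear (\<lambda>x. bracket x y)"
  by (simp add: linear_iff bracket_simps)

lemma linear_bracket_right: "linear (bracket x)"
  by (simp add: linear_iff bracket_simps)

lemma bracket_anticommute: "bracket x y = - bracket y x"
  using bracket_self[of "x + y"] bracket_self[of x] bracket_self[of y]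
  by (simp add: bracket_simps eq_neg_iff_add_eq_0 add.commute)

lemma bracket_derivation:
  "bracket x (bracket y z) = bracket (bracket x y) z + bracket y (bracket x z)"
  using jacobi[of x y z] bracket_anticommute[of z x] bracket_anticommute[of z "bracket x y"]
  by (simp add: bracket_simps algebra_simps)

section \<open>Derived series and representations\<close>

lemma subspace_derived_series: "subspace (derived_series bracket i)"
  by (cases i) auto

lemma derived_series_ideal:
  "x \<in> derived_series bracket i \<Longrightarrow> bracket y x \<in> derived_series bracket i"
proof (induction i arbitrary: x y)
  case (Suc i)
  let ?X = "{bracket x y |x y. x \<in> derived_series bracket i \<and> y \<in> derived_series bracket i}"
  have "x \<in> span ?X" using Suc.prems by simp
  then show ?case
  proof (induction rule: span_induct_alt)
    case base
    show ?case by (simp add: bracket_simps span_zero)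
  next
    case (step c u v)
    then obtain a b where u: "u = bracket a b"
      "a \<in> derived_series bracket i" "b \<in> derived_series bracket i" by blast
    have "bracket (bracket y a) b \<in> span ?X" "bracket a (bracket y b) \<in> span ?X"
      using u Suc.IH by (blast intro: span_base)+
    then have "bracket y u \<in> span ?X"
      unfolding u(1) bracket_derivation[of y] by (rule span_add)
    then show ?case
      using step by (simp add: bracket_simps span_add span_scale)
  qed
qed simp

text \<open>The action is total and only its restriction to \<open>S\<close> matters;
  subrepresentations and quotients then stay in the same type during the induction on
  dimension.\<close>

definition rep_on :: "'a set \<Rightarrow> ('a \<Rightarrow> 'a \<Rightarrow> 'a) \<Rightarrow> bool" where
  "rep_on S \<rho> \<longleftrightarrow> subspace S \<and> bilinear \<rho> \<and> (\<forall>x. \<forall>v\<in>S. \<rho> x v \<in> S) \<and>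
     (\<forall>x y. \<forall>v\<in>S. \<rho> (bracket x y) v = \<rho> x (\<rho> y v) - \<rho> y (\<rho> x v))"

lemma derived_series_Suc_kills:
  assumes \<rho>: "rep_on S \<rho>" and v: "\<And>y z. y \<in> derived_series bracket i \<Longrightarrow>
      z \<in> derived_series bracket i \<Longrightarrow> \<rho> (bracket y z) v = 0"
    and x: "x \<in> derived_series bracket (Suc i)"
  shows "\<rho> x v = 0"
proof -
  have b: "bilinear \<rho>" using \<rho> by (simp add: rep_on_def)
  from x have "x \<in> span {bracket x y |x y. x \<in> derived_series bracket i \<and> y \<in> derived_series bracket i}"
    by simp
  then show ?thesis
    by (induction rule: span_induct_alt)
      (use v in \<open>auto simp: bilinear_lzero[OF b] bilinear_ladd[OF b] bilinear_lmul[OF b]\<close>)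
qed

lemma adjoint_rep: "rep_on UNIV bracket"
proof -
  have "bracket (bracket x y) v = bracket x (bracket y v) - bracket y (bracket x v)" for x y v
    using bracket_derivation[of x y v] by (simp add: eq_diff_eq)
  then show ?thesis
    using bilinear_bracket by (simp add: rep_on_def)
qed

end

locale metric_lie_algebra = fd_lie_algebra bracket + fd_inner_product ip
  for bracket :: "'a::real_vector \<Rightarrow> 'a \<Rightarrow> 'a" and ip :: "'a \<Rightarrow> 'a \<Rightarrow> real"
begin

text \<open>Let g be the whole algebra and h its derived algebra of index \<open>Suc i\<close>,
  which acts commutatively by \<open>triv\<close>. A nonzero kernel that is invariant under g is all
  of \<open>W\<close>, and \<open>commutator_not_injective\<close> supplies the nonzero vectors. At
  first operators are known to commute only within h; so [g, h] is shown to act by 0 before the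
  brackets that generate h.\<close>

lemma irreducible_derived_step:
  assumes rep: "rep_on W \<rho>" and W0: "W \<noteq> {0}"
    and irred: "\<And>U. subspace U \<Longrightarrow> U \<subseteq> W \<Longrightarrow> U \<noteq> {0} \<Longrightarrow> (\<forall>x. \<forall>u\<in>U. \<rho> x u \<in> U) \<Longrightarrow> U = W"
    and triv: "\<And>x v. x \<in> derived_series bracket (Suc (Suc i)) \<Longrightarrow> v \<in> W \<Longrightarrow> \<rho> x v = 0"
    and x: "x \<in> derived_series bracket (Suc i)" and v: "v \<in> W"
  shows "\<rho> x v = 0"
proof -
  let ?h = "derived_series bracket (Suc i)"
  have W: "subspace W" and bil: "bilinear \<rho>" and inv: "\<And>x v. v \<in> W \<Longrightarrow> \<rho> x v \<in> W"
    and hom: "\<And>x y v. v \<in> W \<Longrightarrow> \<rho> (bracket x y) v = \<rho> x (\<rho> y v) - \<rho> y (\<rho> x v)"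
    using rep by (auto simp: rep_on_def)
  note \<rho>_simps = bilinear_ladd[OF bil] bilinear_radd[OF bil] bilinear_lneg[OF bil]
    bilinear_rmul[OF bil] bilinear_rzero[OF bil] bilinear_lzero[OF bil]
  have lin: "linear (\<rho> x)" for x
    using bil by (simp add: bilinear_def)
  have comm: "\<rho> a (\<rho> b v) = \<rho> b (\<rho> a v)" if "a \<in> ?h" "b \<in> ?h" "v \<in> W" for a b v
  proof -
    have "bracket a b \<in> derived_series bracket (Suc (Suc i))"
      using that by (subst derived_series.simps(2)) (blast intro: span_base)
    then show ?thesis
      using triv hom[of v a b] that(3) by simp
  qed
  \<comment> \<open>The disjunction serves two stages: \<open>z\<close> in h, where
    \<open>comm\<close> suffices, and later \<open>y\<close>, \<open>z\<close> one level up in the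
    series, once h is known to act centrally.\<close>
  have sing: "\<exists>v\<in>W. v \<noteq> 0 \<and> \<rho> (bracket y z) v = 0"
    if "z \<in> ?h \<or> (y \<in> derived_series bracket i \<and> z \<in> derived_series bracket i \<and>
        (\<forall>a\<in>?h. \<forall>v\<in>W. \<rho> a (\<rho> z v) = \<rho> z (\<rho> a v)))" for y z
  proof (rule commutator_not_injective[OF W W0 lin[of y] lin[of z] lin[of "bracket y z"]])
    fix v assume "v \<in> W"
    then show "\<rho> y v \<in> W" "\<rho> z v \<in> W" "\<rho> (bracket y z) v \<in> W"
      by (rule inv)+
  next
    fix v assume "v \<in> W"
    then show "\<rho> (bracket y z) v = \<rho> y (\<rho> z v) - \<rho> z (\<rho> y v)" by (rule hom)
    have "bracket y z \<in> ?h"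
      using that derived_series_ideal[of z "Suc i" y] by (auto intro: span_base)
    then show "\<rho> (bracket y z) (\<rho> z v) = \<rho> z (\<rho> (bracket y z) v)"
      using that comm \<open>v \<in> W\<close> by blast
  qed
  have nilp: "\<exists>m. (\<rho> c ^^ m) v = 0" if c: "c = bracket y z" "z \<in> ?h" and v: "v \<in> W" for c y z v
  proof -
    (* This generalized kernel of \<rho> c is invariant, since brackets with c commute with c on W. *)
    define K where "K = {v\<in>W. \<exists>m. (\<rho> c ^^ m) v = 0}"
    have ch: "c \<in> ?h"
      using c derived_series_ideal by blast
    have linp: "linear (\<rho> c ^^ m)" for m
    proof (induction m)
      case (Suc m)
      then show ?case using linear_compose[OF Suc lin[of c]] by (simp add: o_def)
    qed (simp add: linear_iff)
    have invp: "(\<rho> c ^^ m) v \<in> W" if "v \<in> W" for m v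
      by (induction m) (use that inv in auto)
    have mono: "(\<rho> c ^^ (k + m)) v = 0" if "(\<rho> c ^^ m) v = 0" for m k v
      using that linear_0[OF linp[of k]] by (simp add: funpow_add)
    have "subspace K"
    proof (rule subspaceI)
      show "0 \<in> K"
        using subspace_0[OF W] linear_0[OF linp] by (auto simp: K_def)
    next
      fix u w assume "u \<in> K" "w \<in> K"
      then obtain m k where "u \<in> W" "w \<in> W" "(\<rho> c ^^ m) u = 0" "(\<rho> c ^^ k) w = 0"
        by (auto simp: K_def)
      then have "(\<rho> c ^^ (m + k)) (u + w) = 0" "u + w \<in> W"
        using mono[of k w m] mono[of m u k] W
        by (simp_all add: linear_add[OF linp] subspace_add add.commute)
      then show "u + w \<in> K" by (auto simp: K_def)
    next
      fix r u assume "u \<in> K"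
      then show "r *\<^sub>R u \<in> K"
        using W linear_cmul[OF linp] by (auto simp: K_def subspace_scale)
    qed
    moreover have "K \<noteq> {0}"
    proof -
      obtain v where "v \<in> W" "v \<noteq> 0" "\<rho> c v = 0"
        using sing c by blast
      then have "v \<in> K"
        unfolding K_def by (auto intro!: exI[of _ 1])
      then show ?thesis using \<open>v \<noteq> 0\<close> by blast
    qed
    moreover have "\<rho> a u \<in> K" if u: "u \<in> K" for a u
    proof -
      obtain m where m: "(\<rho> c ^^ m) u = 0" and uW: "u \<in> W"
        using u by (auto simp: K_def)
      define d where "d = bracket c a"
      have dh: "d \<in> ?h"
        unfolding d_def bracket_anticommute[of c a]
        using derived_series_ideal[OF ch] subspace_neg[OF subspace_derived_series] by blast
      have dcomm: "(\<rho> c ^^ k) (\<rho> d w) = \<rho> d ((\<rho> c ^^ k) w)" if "w \<in> W" for k w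
        by (induction k) (use that comm[OF ch dh] invp in auto)
      \<comment> \<open>Moving \<open>\<rho> c\<close> past \<open>\<rho> a\<close> produces
        \<open>\<rho> d\<close>, which commutes with \<open>\<rho> c\<close>; every power adds one
        more copy. Hence \<open>Suc m\<close> powers kill \<open>\<rho> a u\<close>.\<close>
      have "(\<rho> c ^^ Suc k) (\<rho> a w) = \<rho> a ((\<rho> c ^^ Suc k) w) + real (Suc k) *\<^sub>R \<rho> d ((\<rho> c ^^ k) w)"
        if w: "w \<in> W" for k w
      proof (induction k)
        case 0
        show ?case using hom[OF w, of c a] by (simp add: d_def)
      next
        case (Suc k)
        have "(\<rho> c ^^ Suc (Suc k)) (\<rho> a w) =
            \<rho> c (\<rho> a ((\<rho> c ^^ Suc k) w)) + real (Suc k) *\<^sub>R \<rho> c (\<rho> d ((\<rho> c ^^ k) w))"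
          using Suc by (simp add: \<rho>_simps)
        also have "\<rho> c (\<rho> a ((\<rho> c ^^ Suc k) w)) =
            \<rho> a ((\<rho> c ^^ Suc (Suc k)) w) + \<rho> d ((\<rho> c ^^ Suc k) w)"
          using hom[OF invp[OF w, of "Suc k"], of c a] by (simp add: d_def)
        also have "\<rho> c (\<rho> d ((\<rho> c ^^ k) w)) = \<rho> d ((\<rho> c ^^ Suc k) w)"
          using comm[OF ch dh invp[OF w]] by simp
        finally show ?case
          by (simp add: scaleR_left_distrib add_ac scaleR_2)
      qed
      then have "(\<rho> c ^^ Suc m) (\<rho> a u) = 0"
        using m uW by (simp add: \<rho>_simps)
      then show ?thesis
        using inv uW unfolding K_def by blast
    qed
    ultimately have "K = W"
      by (intro irred) (auto simp: K_def)
    then show ?thesis using v by (auto simp: K_def)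
  qed
  \<comment> \<open>A common kernel vector of all of [g, h] is found without triangularising: by
    nilpotence each kernel meets \<open>U\<close>, it is invariant under h, and minimality makes it
    all of \<open>U\<close>.\<close>
  obtain U where U: "subspace U" "U \<subseteq> W" "U \<noteq> {0}" "\<forall>a\<in>?h. \<forall>u\<in>U. \<rho> a u \<in> U"
    and Umin: "\<And>V. subspace V \<Longrightarrow> V \<subseteq> U \<Longrightarrow> V \<noteq> {0} \<Longrightarrow> \<forall>a\<in>?h. \<forall>u\<in>V. \<rho> a u \<in> V \<Longrightarrow> V = U"
    using minimal_subspace[OF W W0, of "\<lambda>U. \<forall>a\<in>?h. \<forall>u\<in>U. \<rho> a u \<in> U"] inv by blast
  have Ukill: "\<rho> (bracket y z) u = 0" if z: "z \<in> ?h" and u: "u \<in> U" for y z u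
  proof -
    define c where "c = bracket y z"
    have ch: "c \<in> ?h"
      unfolding c_def by (rule derived_series_ideal[OF z])
    define V where "V = {u\<in>U. \<rho> c u = 0}"
    have "subspace V"
      using U(1) by (auto simp: V_def subspace_def \<rho>_simps)
    moreover have "V \<noteq> {0}"
    proof -
      obtain u where u: "u \<in> U" "u \<noteq> 0"
        using U(1,3) subspace_0 by blast
      define m where "m = (LEAST m. (\<rho> c ^^ m) u = 0)"
      have m: "(\<rho> c ^^ m) u = 0"
        unfolding m_def
      proof (rule LeastI_ex[of "\<lambda>m. (\<rho> c ^^ m) u = 0"])
        show "\<exists>m. (\<rho> c ^^ m) u = 0"
          using nilp[OF c_def z] u(1) U(2) by (meson subsetD)
      qed
      then obtain k where k: "m = Suc k"
        using u(2) by (cases m) auto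
      have "(\<rho> c ^^ k) u \<noteq> 0"
        using not_less_Least[of k "\<lambda>m. (\<rho> c ^^ m) u = 0"] k by (auto simp: m_def)
      moreover have "(\<rho> c ^^ k) u \<in> U"
        by (induction k) (use u U(4) ch in auto)
      ultimately show ?thesis
        using m k by (auto simp: V_def)
    qed
    moreover have "\<forall>a\<in>?h. \<forall>u\<in>V. \<rho> a u \<in> V"
      using U(2,4) comm[OF ch] by (auto simp: V_def \<rho>_simps)
    ultimately have "V = U"
      by (intro Umin) (auto simp: V_def)
    then show ?thesis using u by (auto simp: V_def c_def)
  qed
  \<comment> \<open>The joint kernel of [g, h] is invariant under g because [a, [y, z]] is again a
    bracket with second entry in h.\<close>
  define Z where "Z = {v\<in>W. \<forall>y. \<forall>z\<in>?h. \<rho> (bracket y z) v = 0}"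
  have "Z = W"
  proof (rule irred)
    show "subspace Z"
      using W by (auto simp: Z_def subspace_def \<rho>_simps)
    have "U \<subseteq> Z"
      using U(2) Ukill by (auto simp: Z_def)
    then show "Z \<noteq> {0}"
      using U(1,3) subspace_0 by blast
    show "\<forall>x. \<forall>u\<in>Z. \<rho> x u \<in> Z"
    proof (intro allI ballI)
      fix a u assume u: "u \<in> Z"
      have "\<rho> (bracket y z) (\<rho> a u) = 0" if z: "z \<in> ?h" for y z
      proof -
        have "\<rho> (bracket a (bracket y z)) u = 0" "\<rho> (bracket y z) u = 0"
          using u z derived_series_ideal[OF z] by (auto simp: Z_def)
        then show ?thesis
          using hom[of u a "bracket y z"] u by (simp add: Z_def \<rho>_simps)
      qed
      then show "\<rho> a u \<in> Z"
        using inv u by (auto simp: Z_def)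
    qed
  qed (auto simp: Z_def)
  have central: "\<rho> a (\<rho> y v) = \<rho> y (\<rho> a v)" if "a \<in> ?h" "v \<in> W" for a y v
  proof -
    have "\<rho> (bracket y a) v = 0"
      using that \<open>Z = W\<close> unfolding Z_def by blast
    then show ?thesis
      using hom[OF that(2), of y a] by simp
  qed
  show ?thesis
  proof (rule derived_series_Suc_kills[OF rep _ x])
    fix y z assume yz: "y \<in> derived_series bracket i" "z \<in> derived_series bracket i"
    then have ch: "bracket y z \<in> ?h"
      by (auto intro: span_base)
    define V where "V = {u\<in>W. \<rho> (bracket y z) u = 0}"
    have "V = W"
    proof (rule irred)
      show "subspace V"
        using W by (auto simp: V_def subspace_def \<rho>_simps)
      show "V \<noteq> {0}"
        using sing[of z y] yz central by (auto simp: V_def)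
      show "\<forall>x. \<forall>u\<in>V. \<rho> x u \<in> V"
        using inv central[OF ch] by (auto simp: V_def \<rho>_simps)
    qed (auto simp: V_def)
    then show "\<rho> (bracket y z) v = 0"
      using v by (auto simp: V_def)
  qed
qed

lemma irreducible_derived_trivial:
  assumes rep: "rep_on W \<rho>" and W0: "W \<noteq> {0}"
    and irred: "\<And>U. subspace U \<Longrightarrow> U \<subseteq> W \<Longrightarrow> U \<noteq> {0} \<Longrightarrow> (\<forall>x. \<forall>u\<in>U. \<rho> x u \<in> U) \<Longrightarrow> U = W"
    and solv: "solvable_lie bracket"
    and x: "x \<in> derived_series bracket (Suc 0)" and v: "v \<in> W"
  shows "\<rho> x v = 0"
proof -
  obtain n where n: "derived_series bracket n = {0}"
    using solv by (auto simp: solvable_lie_def)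
  have b: "bilinear \<rho>" using rep by (simp add: rep_on_def)
  \<comment> \<open>Starting one level below \<open>n\<close> covers \<open>n = 0\<close> as well;
    that level is spanned by brackets of zeros.\<close>
  have "\<forall>x\<in>derived_series bracket (Suc n). \<forall>v\<in>W. \<rho> x v = 0"
    using derived_series_Suc_kills[OF rep, of n] n
    by (auto simp: bilinear_lzero[OF b] bracket_simps simp del: derived_series.simps(2))
  then have "\<forall>x\<in>derived_series bracket (Suc 0). \<forall>v\<in>W. \<rho> x v = 0"
  proof (induction n)
    case (Suc n)
    then show ?case
      using irreducible_derived_step[OF rep W0 irred, of n] by blast
  qed
  then show ?thesis using x v by blast
qed

text \<open>Induction along a minimal subrepresentation \<open>W\<close>, on which the derived
  algebra acts by 0. The quotient of \<open>S\<close> by \<open>W\<close> is modelled on the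
  orthogonal complement of \<open>W\<close> with the compressed action \<open>\<sigma>\<close>. The
  basis is existential because it is assembled along the way; \<open>trace_square_derived\<close>
  passes to an arbitrary one.\<close>

lemma trace_square_derived_rep:
  assumes "rep_on S \<rho>" and solv: "solvable_lie bracket"
  shows "\<exists>E. onb E S \<and>
    (\<forall>x\<in>derived_series bracket (Suc 0). (\<Sum>e\<in>E. ip (\<rho> x (\<rho> x e)) e) = 0)"
  using assms(1)
proof (induction "dim S" arbitrary: S \<rho> rule: less_induct)
  case less
  note rep = less.prems
  have S: "subspace S" and bil: "bilinear \<rho>" and inv: "\<And>x v. v \<in> S \<Longrightarrow> \<rho> x v \<in> S"
    and hom: "\<And>x y v. v \<in> S \<Longrightarrow> \<rho> (bracket x y) v = \<rho> x (\<rho> y v) - \<rho> y (\<rho> x v)"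
    using rep by (auto simp: rep_on_def)
  note \<rho>_simps = bilinear_ladd[OF bil] bilinear_radd[OF bil] bilinear_lmul[OF bil]
    bilinear_rmul[OF bil] bilinear_rzero[OF bil] bilinear_lzero[OF bil]
  show ?case
  proof (cases "S = {0}")
    case True
    then show ?thesis
      by (intro exI[of _ "{}"]) (auto simp: onb_def orthonormal_def)
  next
    case False
    obtain W where W: "subspace W" "W \<subseteq> S" "W \<noteq> {0}" "\<forall>x. \<forall>u\<in>W. \<rho> x u \<in> W"
      and Wmin: "\<And>U. subspace U \<Longrightarrow> U \<subseteq> W \<Longrightarrow> U \<noteq> {0} \<Longrightarrow> \<forall>x. \<forall>u\<in>U. \<rho> x u \<in> U \<Longrightarrow> U = W"
      using minimal_subspace[OF S False, of "\<lambda>U. \<forall>x. \<forall>u\<in>U. \<rho> x u \<in> U"] inv by blast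
    have repW: "rep_on W \<rho>"
      using rep W by (auto simp: rep_on_def)
    have kill: "\<rho> x v = 0" if "x \<in> derived_series bracket (Suc 0)" "v \<in> W" for x v
      using irreducible_derived_trivial[OF repW W(3) Wmin solv] that by blast
    obtain F where F: "onb F W" using onb_exists[OF W(1)] by blast
    then have "orthonormal F" "F \<subseteq> S"
      using W(2) span_superset[of F] by (auto simp: onb_def)
    then obtain E where E: "F \<subseteq> E" "onb E S"
      using onb_extend[OF S] by blast
    define G where "G = E - F"
    have fin: "finite E" "finite F" "finite G"
      using E F by (auto simp: onb_def orthonormal_def G_def)
    have G: "onb G (span G)"
      using E(2) by (auto simp: onb_def orthonormal_def G_def)
    have EFG: "E = F \<union> G" "F \<inter> G = {}"
      using E(1) by (auto simp: G_def)
    have GS: "span G \<subseteq> S"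
      using E(2) span_mono[of G E] by (auto simp: onb_def G_def)
    define Q where "Q v = (\<Sum>e\<in>G. ip v e *\<^sub>R e)" for v
    have linQ: "linear Q"
      by (simp add: linear_iff Q_def ip_simps scaleR_left_distrib sum.distrib scaleR_sum_right)
    have QG: "Q v \<in> span G" for v
      unfolding Q_def by (intro span_sum span_scale span_base)
    have orth: "ip w g = 0" if "w \<in> W" "g \<in> span G" for w g
    proof -
      have "ip f e = 0" if "f \<in> F" "e \<in> G" for f e
        using E that by (auto simp: onb_def orthonormal_def G_def)
      then have "ip (\<Sum>f\<in>F. ip w f *\<^sub>R f) (\<Sum>e\<in>G. ip g e *\<^sub>R e) = 0"
        by (simp add: ip_sum_left ip_sum_right ip_simps)
      then show ?thesis
        using onb_expand[OF F \<open>w \<in> W\<close>] onb_expand[OF G \<open>g \<in> span G\<close>] by simp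
    qed
    have QW: "Q w = 0" if "w \<in> W" for w
      using orth[OF that] by (simp add: Q_def span_base)
    have split: "\<exists>w\<in>W. v = w + Q v" if "v \<in> S" for v
    proof
      show "v = (\<Sum>e\<in>F. ip v e *\<^sub>R e) + Q v"
        using onb_expand[OF E(2) that] EFG fin by (simp add: Q_def sum.union_disjoint)
      show "(\<Sum>e\<in>F. ip v e *\<^sub>R e) \<in> W"
        using F unfolding onb_def by (metis (no_types, lifting) span_base span_scale span_sum)
    qed
    have Qip: "ip (Q v) g = ip v g" if v: "v \<in> S" and g: "g \<in> span G" for v g
    proof -
      obtain w where w: "w \<in> W" "v = w + Q v" using split[OF v] by blast
      have "ip v g = ip w g + ip (Q v) g"
        by (subst w(2)) (simp add: ip_simps)
      then show ?thesis using orth[OF w(1) g] by simp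
    qed
    define \<sigma> where "\<sigma> x v = Q (\<rho> x v)" for x v
    \<comment> \<open>\<open>W\<close> is invariant and \<open>Q\<close> kills it, so compression is
      compatible with composition, as in a quotient.\<close>
    have Q\<rho>Q: "Q (\<rho> x (Q v)) = Q (\<rho> x v)" if v: "v \<in> S" for x v
    proof -
      obtain w where w: "w \<in> W" "v = w + Q v" using split[OF v] by blast
      have "Q (\<rho> x v) = Q (\<rho> x w) + Q (\<rho> x (Q v))"
        by (subst w(2)) (simp add: \<rho>_simps linear_add[OF linQ])
      then show ?thesis using QW W(4) w(1) by simp
    qed
    have "rep_on (span G) \<sigma>"
      unfolding rep_on_def
    proof (intro conjI allI ballI)
      show "bilinear \<sigma>"
        by (simp add: bilinear_def linear_iff \<sigma>_def \<rho>_simps linear_add[OF linQ] linear_cmul[OF linQ])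
      fix x y v assume "v \<in> span G"
      then have "v \<in> S" using GS by blast
      then show "\<sigma> (bracket x y) v = \<sigma> x (\<sigma> y v) - \<sigma> y (\<sigma> x v)"
        using hom Q\<rho>Q inv by (simp add: \<sigma>_def linear_diff[OF linQ])
    qed (auto simp: \<sigma>_def QG)
    moreover have "dim (span G) < dim S"
    proof -
      have "F \<noteq> {}"
        using F W(3) by (auto simp: onb_def)
      then show ?thesis
        using onb_card[OF G] onb_card[OF E(2)] fin EFG by (simp add: card_Un_disjoint card_gt_0_iff)
    qed
    ultimately obtain D where D: "onb D (span G)"
      and tr: "\<And>x. x \<in> derived_series bracket (Suc 0) \<Longrightarrow> (\<Sum>e\<in>D. ip (\<sigma> x (\<sigma> x e)) e) = 0"
      using less.hyps[of "span G" \<sigma>] by blast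
    have DG: "e \<in> span G" if "e \<in> D" for e
      using D that span_base by (auto simp: onb_def)
    have FW: "e \<in> W" if "e \<in> F" for e
      using F that span_base by (auto simp: onb_def)
    have FD: "ip f d = 0" "ip d f = 0" if "f \<in> F" "d \<in> D" for f d
      using orth[of f d] DG FW that by (auto simp: ip_commute[of d])
    have disj: "F \<inter> D = {}" and finD: "finite D"
      using FD F D by (auto simp: onb_def orthonormal_def) (metis one_neq_zero)
    have "span (F \<union> D) = span (F \<union> G)"
      using D by (simp add: span_Un onb_def)
    then have "onb (F \<union> D) S"
      using E(2) EFG(1) F D FD disj finD unfolding onb_def orthonormal_def by auto
    moreover have "(\<Sum>e\<in>F \<union> D. ip (\<rho> x (\<rho> x e)) e) = 0"
      if x: "x \<in> derived_series bracket (Suc 0)" for x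
    proof -
      have "(\<Sum>e\<in>F \<union> D. ip (\<rho> x (\<rho> x e)) e) =
          (\<Sum>e\<in>F. ip (\<rho> x (\<rho> x e)) e) + (\<Sum>e\<in>D. ip (\<rho> x (\<rho> x e)) e)"
        using fin finD disj by (simp add: sum.union_disjoint)
      also have "(\<Sum>e\<in>F. ip (\<rho> x (\<rho> x e)) e) = 0"
        using kill[OF x FW] by (simp add: \<rho>_simps ip_simps)
      also have "(\<Sum>e\<in>D. ip (\<rho> x (\<rho> x e)) e) = (\<Sum>e\<in>D. ip (\<sigma> x (\<sigma> x e)) e)"
      proof (rule sum.cong[OF refl])
        fix e assume "e \<in> D"
        then have e: "e \<in> span G" "e \<in> S" using DG GS by auto
        then show "ip (\<rho> x (\<rho> x e)) e = ip (\<sigma> x (\<sigma> x e)) e"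
          using Qip[OF inv[OF inv[OF e(2)]] e(1), of x x] Q\<rho>Q[OF inv[OF e(2)], of x x]
          by (simp add: \<sigma>_def)
      qed
      finally show ?thesis
        using tr[OF x] by simp
    qed
    ultimately show ?thesis by blast
  qed
qed

theorem trace_square_derived:
  assumes "solvable_lie bracket" "x \<in> derived_series bracket (Suc 0)" and E: "onb E UNIV"
  shows "(\<Sum>e\<in>E. ip (bracket x (bracket x e)) e) = 0"
proof -
  obtain D where D: "onb D UNIV" "(\<Sum>e\<in>D. ip (bracket x (bracket x e)) e) = 0"
    using trace_square_derived_rep[OF adjoint_rep assms(1)] assms(2) by blast
  have "linear (\<lambda>v. bracket x (bracket x v))"
    by (simp add: linear_iff bracket_simps)
  then show ?thesis
    using lin_trace_onb[OF _ D(1)] lin_trace_onb[OF _ E] D(2) by metis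
qed

end

section \<open>Curvature of unimodular metric Lie algebras\<close>

context metric_lie_algebra
begin

abbreviation nabla :: "'a \<Rightarrow> 'a \<Rightarrow> 'a" where
  "nabla \<equiv> levi_civita bracket ip"

lemmas koszul = levi_civita_koszul[OF inner_product]

lemma bilinear_nabla: "bilinear nabla"
  unfolding bilinear_def linear_iff
  by (auto intro!: ip_eqI simp: koszul ip_simps bracket_simps field_simps)

lemmas nabla_simps =
  bilinear_ladd[OF bilinear_nabla] bilinear_radd[OF bilinear_nabla]
  bilinear_lsub[OF bilinear_nabla] bilinear_rsub[OF bilinear_nabla]
  bilinear_lneg[OF bilinear_nabla] bilinear_rneg[OF bilinear_nabla]
  bilinear_lmul[OF bilinear_nabla] bilinear_rmul[OF bilinear_nabla]
  bilinear_lzero[OF bilinear_nabla] bilinear_rzero[OF bilinear_nabla]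

lemma linear_nabla_left: "linear (\<lambda>x. nabla x y)"
  by (simp add: linear_iff nabla_simps)

lemma linear_nabla_right: "linear (nabla x)"
  by (simp add: linear_iff nabla_simps)

lemma nabla_torsion_free: "nabla x y - nabla y x = bracket x y"
proof (rule ip_eqI)
  fix z
  show "ip (nabla x y - nabla y x) z = ip (bracket x y) z"
    using bracket_anticommute[of y x] bracket_anticommute[of x z] bracket_anticommute[of z y]
    by (simp add: koszul ip_simps field_simps)
qed

lemma nabla_metric: "ip (nabla x y) z = - ip y (nabla x z)"
  unfolding ip_commute[of y] koszul
  using bracket_anticommute[of y x] bracket_anticommute[of x z] bracket_anticommute[of z y]
  by (simp add: ip_simps field_simps)

text \<open>Uniqueness of the torsion-free metric connection; \<open>nabla_decomposition\<close>
  uses it to recognise an explicit formula as \<open>nabla\<close>.\<close>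

lemma nabla_unique:
  assumes "\<And>x y. L x y - L y x = bracket x y" "\<And>x y z. ip (L x y) z = - ip y (L x z)"
  shows "nabla x y = L x y"
proof (rule ip_eqI)
  fix z
  have "ip (L y x) z = - ip (L y z) x" "ip (L z y) x = - ip (L z x) y" "ip (L x z) y = - ip (L x y) z"
    using assms(2) ip_commute by metis+
  then show "ip (nabla x y) z = ip (L x y) z"
    unfolding koszul assms(1)[symmetric] by (simp add: ip_simps field_simps)
qed

section \<open>Curvature tensor and trace of the connection\<close>

definition curvature :: "'a \<Rightarrow> 'a \<Rightarrow> 'a \<Rightarrow> 'a" where
  "curvature x y z = nabla x (nabla y z) - nabla y (nabla x z) - nabla (bracket x y) z"

lemma bianchi: "curvature x y z + curvature y z x + curvature z x y = 0"
proof -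
  have "curvature x y z + curvature y z x + curvature z x y =
      (nabla x (bracket y z) - nabla (bracket y z) x) +
      (nabla y (bracket z x) - nabla (bracket z x) y) +
      (nabla z (bracket x y) - nabla (bracket x y) z)"
    unfolding curvature_def nabla_torsion_free[of y z, symmetric]
      nabla_torsion_free[of z x, symmetric] nabla_torsion_free[of x y, symmetric]
    by (simp add: nabla_simps algebra_simps)
  then show ?thesis
    by (simp add: nabla_torsion_free jacobi)
qed

lemma curvature_antisym: "curvature x y z = - curvature y x z"
  by (simp add: curvature_def bracket_anticommute[of x y] nabla_simps)

lemma bilinear_curvature: "bilinear (\<lambda>x z. curvature x y z)"
  by (simp add: bilinear_def linear_iff curvature_def nabla_simps bracket_simps algebra_simps)

text \<open>The sum is dual to the 1-form tr (ad z): the term <\<open>nabla e e\<close>, z> equals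
  <[z, e], e> because \<open>nabla z\<close> is skew.\<close>

lemma nabla_trace:
  assumes E: "onb E UNIV" and tr: "\<And>x. (\<Sum>e\<in>E. ip (bracket x e) e) = 0"
  shows "(\<Sum>e\<in>E. nabla e e) = 0"
proof (rule ip_eqI)
  fix z
  have "ip (nabla e e) z = ip (bracket z e) e" for e
  proof -
    have "ip (nabla z e) e = 0"
      using nabla_metric[of z e e] ip_commute[of e "nabla z e"] by simp
    then show ?thesis
      using nabla_metric[of e e z] arg_cong[OF nabla_torsion_free[of z e], of "\<lambda>v. ip v e"]
      by (simp add: ip_simps ip_commute[of e])
  qed
  then show "ip (\<Sum>e\<in>E. nabla e e) z = ip 0 z"
    using tr by (simp add: ip_sum_left ip_simps)
qed

end

text \<open>A Kaehler Lie algebra, except that \<open>\<phi>\<close> may have a kernel, to which all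
  values of \<open>nabla\<close> are orthogonal. Solvability enters only through its trace
  consequence, which is easy to transfer from the original bracket to its horizontal part.\<close>

locale unimodular_parallel = metric_lie_algebra bracket ip
  for bracket :: "'a::real_vector \<Rightarrow> 'a \<Rightarrow> 'a" and ip :: "'a \<Rightarrow> 'a \<Rightarrow> real" +
  fixes \<phi> :: "'a \<Rightarrow> 'a"
  assumes linear_\<phi>: "linear \<phi>"
    and \<phi>_skew: "ip (\<phi> x) y = - ip x (\<phi> y)"
    and \<phi>_parallel: "nabla x (\<phi> y) = \<phi> (nabla x y)"
    and \<phi>_sq_nabla: "\<phi> (\<phi> (nabla x y)) = - nabla x y"
    and trace_ad: "onb E UNIV \<Longrightarrow> (\<Sum>e\<in>E. ip (bracket x e) e) = 0"
    and trace_ad_square: "onb E UNIV \<Longrightarrow> x \<in> span (range (\<lambda>(x, y). bracket x y)) \<Longrightarrow>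
      (\<Sum>e\<in>E. ip (bracket x (bracket x e)) e) = 0"
begin

lemmas \<phi>_simps = linear_add[OF linear_\<phi>] linear_diff[OF linear_\<phi>] linear_neg[OF linear_\<phi>]
  linear_cmul[OF linear_\<phi>] linear_0[OF linear_\<phi>] linear_sum[OF linear_\<phi>]

lemma curvature_\<phi>: "curvature x y (\<phi> z) = \<phi> (curvature x y z)"
  by (simp add: curvature_def \<phi>_parallel \<phi>_simps)

lemma \<phi>_sq_curvature: "\<phi> (\<phi> (curvature x y z)) = - curvature x y z"
  by (simp add: curvature_def \<phi>_simps \<phi>_sq_nabla)

text \<open>\<open>\<phi>\<close> commutes with every \<open>nabla x\<close>, so by cyclicity the
  commutator part has trace 0. What remains is the differential of the 1-form tr
  (\<open>\<phi>\<close> \<open>nabla x\<close>): exactness of the Ricci form.\<close>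

lemma curvature_trace_\<phi>:
  assumes E: "onb E UNIV"
  shows "(\<Sum>e\<in>E. ip (\<phi> (curvature x y e)) e) = - (\<Sum>e\<in>E. ip (\<phi> (nabla (bracket x y) e)) e)"
proof -
  have "(\<Sum>e\<in>E. ip (\<phi> (nabla x (nabla y e))) e) = (\<Sum>e\<in>E. ip (\<phi> (nabla y (nabla x e))) e)"
    using trace_commute[OF E _ _ linear_nabla_right[of y], of "\<lambda>v. \<phi> (nabla x v)"]
    by (simp add: linear_iff nabla_simps \<phi>_simps \<phi>_parallel)
  then show ?thesis
    by (simp add: curvature_def \<phi>_simps ip_simps sum_subtractf)
qed

text \<open>Skewness of \<open>\<phi>\<close> identifies the two torsion terms up to sign, and
  \<open>\<phi>\<close> moves out of \<open>nabla\<close>, leaving the sum that unimodularity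
  kills.\<close>

lemma sum_bracket_\<phi>:
  assumes E: "onb E UNIV"
  shows "(\<Sum>e\<in>E. bracket e (\<phi> e)) = 0"
proof -
  have "(\<Sum>e\<in>E. bracket e (\<phi> e)) = 2 *\<^sub>R (\<Sum>e\<in>E. nabla e (\<phi> e))"
    using sum_onb_skew[OF E bilinear_nabla \<phi>_skew]
    by (simp add: sum_subtractf scaleR_2 flip: nabla_torsion_free)
  also have "(\<Sum>e\<in>E. nabla e (\<phi> e)) = \<phi> (\<Sum>e\<in>E. nabla e e)"
    by (simp add: \<phi>_parallel \<phi>_simps)
  finally show ?thesis
    using nabla_trace[OF E trace_ad[OF E]] by (simp add: \<phi>_simps)
qed

text \<open>The Ricci form is exact, so its contraction with \<open>\<phi>\<close> vanishes; by the Bianchi identity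
  this contraction is twice the scalar curvature.\<close>

lemma scalar_curvature_zero:
  assumes E: "onb E UNIV"
  shows "(\<Sum>j\<in>E. \<Sum>i\<in>E. ip (curvature j i i) j) = 0"
proof -
  have 1: "(\<Sum>i\<in>E. \<Sum>e\<in>E. ip (\<phi> (curvature i (\<phi> i) e)) e) = 0"
  proof -
    have "(\<Sum>i\<in>E. \<Sum>e\<in>E. ip (\<phi> (curvature i (\<phi> i) e)) e)
        = - (\<Sum>e\<in>E. \<Sum>i\<in>E. ip (\<phi> (nabla (bracket i (\<phi> i)) e)) e)"
      by (subst sum.swap[of _ E E]) (simp add: curvature_trace_\<phi>[OF E] sum_negf)
    also have "\<dots> = - (\<Sum>e\<in>E. ip (\<phi> (nabla (\<Sum>i\<in>E. bracket i (\<phi> i)) e)) e)"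
      by (simp add: linear_sum[OF linear_nabla_left] \<phi>_simps ip_sum_left)
    finally show ?thesis
      by (simp add: sum_bracket_\<phi>[OF E] nabla_simps \<phi>_simps ip_simps)
  qed
  have 2: "ip (curvature j i (\<phi> i)) (\<phi> j) = ip (curvature j i i) j" for i j
    using \<phi>_skew[of "\<phi> (curvature j i i)" j] by (simp add: curvature_\<phi> \<phi>_sq_curvature ip_simps)
  \<comment> \<open>The Bianchi identity for i, \<open>\<phi>\<close> i, j leaves two terms. Moving
    \<open>\<phi>\<close> across the sum over i makes them equal, which is the factor 2, and fact 2
    then removes \<open>\<phi>\<close>.\<close>
  have 3: "(\<Sum>i\<in>E. ip (\<phi> (curvature i (\<phi> i) j)) j) = 2 * (\<Sum>i\<in>E. ip (curvature j i i) j)" for j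
  proof -
    have "ip (\<phi> (curvature i (\<phi> i) j)) j
        = ip (curvature (\<phi> i) j i) (\<phi> j) + ip (curvature j i (\<phi> i)) (\<phi> j)" for i
    proof -
      have "curvature i (\<phi> i) j = - (curvature (\<phi> i) j i + curvature j i (\<phi> i))"
        using bianchi[of i "\<phi> i" j] by (simp only: eq_neg_iff_add_eq_0 add.assoc)
      then show ?thesis by (simp add: \<phi>_skew ip_simps)
    qed
    moreover have "(\<Sum>i\<in>E. ip (curvature (\<phi> i) j i) (\<phi> j)) = (\<Sum>i\<in>E. ip (curvature j i (\<phi> i)) (\<phi> j))"
    proof -
      have "bilinear (\<lambda>x z. ip (curvature x j z) (\<phi> j))"
        using bilinear_curvature[of j] by (simp add: bilinear_def linear_iff ip_simps)
      from sum_onb_skew[OF E this \<phi>_skew] show ?thesis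
        by (simp add: curvature_antisym[of _ j] ip_simps sum_negf)
    qed
    ultimately show ?thesis
      by (simp add: sum.distrib 2)
  qed
  have "(\<Sum>j\<in>E. 2 * (\<Sum>i\<in>E. ip (curvature j i i) j)) = 0"
    using 1 by (subst (asm) sum.swap) (simp add: 3)
  then show ?thesis
    by (simp flip: sum_distrib_left)
qed

text \<open>With \<open>T\<close>, \<open>X\<close>, \<open>Y\<close> for the three sums, skewness
  of the connection gives \<open>X = T\<close> and \<open>Y = - X\<close>. The scalar curvature is
  \<open>T - X + Y\<close>, that is \<open>- T\<close>, so all three vanish with it.\<close>

lemma nabla_sums_zero:
  assumes E: "onb E UNIV"
  shows "(\<Sum>i\<in>E. \<Sum>j\<in>E. ip (nabla i j) (nabla j i)) = 0"
    and "(\<Sum>i\<in>E. \<Sum>j\<in>E. ip (nabla (nabla j i) i) j) = 0"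
    and "(\<Sum>i\<in>E. \<Sum>j\<in>E. ip (nabla (nabla i j) i) j) = 0"
proof -
  define T where "T = (\<Sum>i\<in>E. \<Sum>j\<in>E. ip (nabla i j) (nabla j i))"
  define X where "X = (\<Sum>i\<in>E. \<Sum>j\<in>E. ip (nabla (nabla j i) i) j)"
  define Y where "Y = (\<Sum>i\<in>E. \<Sum>j\<in>E. ip (nabla (nabla i j) i) j)"
  have XT: "X = T"
  proof -
    have "(\<Sum>i\<in>E. ip (nabla (nabla j i) i) j) = (\<Sum>i\<in>E. ip (nabla i j) (nabla j i))" for j
    proof -
      have "bilinear (\<lambda>x z. ip (nabla x z) j)"
        by (simp add: bilinear_def linear_iff ip_simps nabla_simps)
      from sum_onb_skew[OF E this nabla_metric] show ?thesis
        by (simp add: nabla_metric sum_negf ip_commute)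
    qed
    then show ?thesis
      unfolding X_def T_def by (subst (1 2) sum.swap) simp
  qed
  have YX: "Y = - X"
  proof -
    have "ip (nabla (nabla i j) i) j = - ip (nabla (nabla i j) j) i" for i j
      using nabla_metric[of "nabla i j" i j] ip_commute[of i] by simp
    then have "Y = - (\<Sum>i\<in>E. \<Sum>j\<in>E. ip (nabla (nabla i j) j) i)"
      unfolding Y_def by (simp add: sum_negf)
    then show ?thesis
      unfolding X_def by (subst sum.swap)
  qed
  have "(\<Sum>j\<in>E. \<Sum>i\<in>E. ip (nabla j (nabla i i)) j) = (\<Sum>j\<in>E. ip (nabla j (\<Sum>i\<in>E. nabla i i)) j)"
    by (simp add: linear_sum[OF linear_nabla_right] ip_sum_left)
  then have H: "(\<Sum>j\<in>E. \<Sum>i\<in>E. ip (nabla j (nabla i i)) j) = 0"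
    by (simp add: nabla_trace[OF E trace_ad[OF E]] nabla_simps ip_simps)
  have "ip (curvature j i i) j = ip (nabla j (nabla i i)) j + ip (nabla i j) (nabla j i)
      - ip (nabla (nabla j i) i) j + ip (nabla (nabla i j) i) j" for i j
    using nabla_metric[of i "nabla j i" j] ip_commute
    by (simp add: curvature_def ip_simps nabla_simps flip: nabla_torsion_free)
  then have "T - X + Y = (\<Sum>j\<in>E. \<Sum>i\<in>E. ip (curvature j i i) j)"
    unfolding T_def X_def Y_def
    by (subst (1 2 3) sum.swap) (simp add: sum.distrib sum_subtractf H)
  then have "T - X + Y = 0"
    using scalar_curvature_zero[OF E] by simp
  then show "T = 0" "X = 0" "Y = 0"
    using XT YX by auto
qed

text \<open>The left-hand side is -4 times the scalar curvature. Given
  \<open>nabla_sums_zero\<close>, both double sums reduce to the squared norm \<open>N\<close> of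
  the connection, namely to 2 N and - N.\<close>

lemma bracket_square_sum:
  assumes E: "onb E UNIV"
  shows "(\<Sum>i\<in>E. \<Sum>j\<in>E. ip (bracket i j) (bracket i j))
    + 2 * (\<Sum>i\<in>E. \<Sum>j\<in>E. ip (bracket i (bracket i j)) j) = 0"
proof -
  define N where "N = (\<Sum>i\<in>E. \<Sum>j\<in>E. ip (nabla i j) (nabla i j))"
  have N': "(\<Sum>i\<in>E. \<Sum>j\<in>E. ip (nabla j i) (nabla j i)) = N"
    unfolding N_def by (rule sum.swap)
  have "ip (bracket i j) (bracket i j) = ip (nabla i j) (nabla i j) + ip (nabla j i) (nabla j i)
      - 2 * ip (nabla i j) (nabla j i)" for i j
    by (simp add: ip_simps ip_commute[of "nabla j i" "nabla i j"] flip: nabla_torsion_free)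
  then have A: "(\<Sum>i\<in>E. \<Sum>j\<in>E. ip (bracket i j) (bracket i j)) = 2 * N"
    using N' nabla_sums_zero(1)[OF E]
    by (simp add: sum.distrib sum_subtractf N_def flip: sum_distrib_left)
  have "ip (bracket i (bracket i j)) j = - ip (nabla i j) (nabla i j) + ip (nabla i j) (nabla j i)
      - ip (nabla (nabla i j) i) j + ip (nabla (nabla j i) i) j" for i j
    unfolding nabla_torsion_free[of i "bracket i j", symmetric]
    using nabla_metric[of i "nabla i j" j] nabla_metric[of i "nabla j i" j]
      ip_commute[of "nabla j i" "nabla i j"]
    by (simp add: ip_simps nabla_simps flip: nabla_torsion_free)
  then have "(\<Sum>i\<in>E. \<Sum>j\<in>E. ip (bracket i (bracket i j)) j) = - N"
    using nabla_sums_zero[OF E] by (simp add: sum.distrib sum_subtractf sum_negf N_def)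
  then show ?thesis using A by simp
qed

section \<open>Structure forced by vanishing scalar curvature\<close>

lemma onb_component:
  assumes E: "onb E UNIV" "E = F \<union> G" "F \<inter> G = {}"
  shows "x - (\<Sum>e\<in>F. ip x e *\<^sub>R e) = (\<Sum>e\<in>G. ip x e *\<^sub>R e)"
proof -
  have "finite E"
    using E(1) by (simp add: onb_def orthonormal_def)
  then have "x = (\<Sum>e\<in>F. ip x e *\<^sub>R e) + (\<Sum>e\<in>G. ip x e *\<^sub>R e)"
    using onb_expand[OF E(1), of x] E(2,3) by (simp add: sum.union_disjoint)
  then show ?thesis by (simp add: algebra_simps)
qed

text \<open>Splitting an orthonormal basis along the derived algebra turns
  \<open>bracket_square_sum\<close> into a vanishing sum of squares.\<close>

lemma adapted_onb:
  obtains F G where "onb (F \<union> G) UNIV" "F \<inter> G = {}" "onb F (span (range (\<lambda>(x, y). bracket x y)))"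
    "\<And>e f. e \<in> F \<Longrightarrow> f \<in> F \<Longrightarrow> bracket e f = 0"
    "\<And>e f. e \<in> G \<Longrightarrow> f \<in> G \<Longrightarrow> bracket e f = 0"
    "\<And>a e f. a \<in> G \<Longrightarrow> e \<in> F \<Longrightarrow> f \<in> F \<Longrightarrow> ip (bracket a e) f = - ip e (bracket a f)"
proof -
  let ?n = "span (range (\<lambda>(x, y). bracket x y))"
  have br: "bracket x y \<in> ?n" for x y
    by (rule span_base) auto
  obtain F where F: "onb F ?n" using onb_exists[of ?n] by auto
  then obtain E where E: "F \<subseteq> E" "onb E UNIV"
    using onb_extend[OF subspace_UNIV, of F] by (auto simp: onb_def)
  define G where "G = E - F"
  have fin: "finite E" "finite F" "finite G"
    using E F by (auto simp: onb_def orthonormal_def G_def)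
  have EFG: "E = F \<union> G" "F \<inter> G = {}"
    using E(1) by (auto simp: G_def)
  have Fn: "e \<in> ?n" if "e \<in> F" for e
    using F that unfolding onb_def by (metis span_base)
  have orth: "ip v g = 0" if "v \<in> ?n" "g \<in> G" for v g
  proof -
    have "ip f g = 0" if "f \<in> F" for f
      using E that \<open>g \<in> G\<close> by (auto simp: onb_def orthonormal_def G_def)
    then have "ip (\<Sum>f\<in>F. ip v f *\<^sub>R f) g = 0"
      by (simp add: ip_sum_left ip_simps)
    then show ?thesis
      using onb_expand[OF F that(1)] by simp
  qed
  define D where "D a j k = ip (bracket a j) k" for a j k
  have sqF: "ip (bracket a j) (bracket a j) = (\<Sum>k\<in>F. (D a j k)\<^sup>2)" for a j
    using onb_parseval[OF F br[of a j], of "bracket a j"] by (simp add: D_def power2_eq_square)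
  have trF: "ip (bracket a (bracket a j)) l = (\<Sum>k\<in>F. D a j k * D a k l)" for a j l
  proof -
    have "ip (bracket a (bracket a j)) l = ip (bracket a (\<Sum>k\<in>F. ip (bracket a j) k *\<^sub>R k)) l"
      using onb_expand[OF F br[of a j]] by simp
    then show ?thesis
      by (simp add: linear_sum[OF linear_bracket_right] bracket_simps ip_sum_left ip_simps D_def)
  qed
  \<comment> \<open>This is the squared norm of \<open>D a\<close> plus its transpose; if it
    vanishes, \<open>ad a\<close> is skew on the derived algebra.\<close>
  have sym: "2 * (\<Sum>j\<in>F. ip (bracket a j) (bracket a j)) + 2 * (\<Sum>j\<in>F. ip (bracket a (bracket a j)) j)
      = (\<Sum>j\<in>F. \<Sum>k\<in>F. (D a j k + D a k j)\<^sup>2)" for a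
  proof -
    have "(\<Sum>j\<in>F. \<Sum>k\<in>F. (D a j k + D a k j)\<^sup>2) = (\<Sum>j\<in>F. \<Sum>k\<in>F. (D a j k)\<^sup>2)
        + (\<Sum>j\<in>F. \<Sum>k\<in>F. (D a k j)\<^sup>2) + 2 * (\<Sum>j\<in>F. \<Sum>k\<in>F. D a j k * D a k j)"
      by (simp add: power2_sum sum.distrib sum_distrib_left mult.assoc)
    also have "(\<Sum>j\<in>F. \<Sum>k\<in>F. (D a k j)\<^sup>2) = (\<Sum>j\<in>F. \<Sum>k\<in>F. (D a j k)\<^sup>2)"
      by (rule sum.swap)
    finally show ?thesis
      by (simp add: sqF trF)
  qed
  define sq where "sq A B = (\<Sum>i\<in>A. \<Sum>j\<in>B. ip (bracket i j) (bracket i j))" for A B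
  have sq_nonneg: "sq A B \<ge> 0" for A B
    unfolding sq_def by (intro sum_nonneg ip_nonneg)
  have "sq E E = sq F F + sq F G + sq G F + sq G G"
    using fin EFG by (simp add: sq_def sum.union_disjoint sum.distrib)
  moreover have "sq F G = sq G F"
  proof -
    have "ip (bracket i j) (bracket i j) = ip (bracket j i) (bracket j i)" for i j
      using bracket_anticommute[of i j] by (simp add: ip_simps)
    then show ?thesis
      unfolding sq_def by (subst sum.swap) (intro sum.cong refl)
  qed
  \<comment> \<open>Terms with i in \<open>F\<close> vanish by the trace condition, terms with j in
    \<open>G\<close> because brackets are orthogonal to \<open>G\<close>.\<close>
  moreover have "(\<Sum>i\<in>E. \<Sum>j\<in>E. ip (bracket i (bracket i j)) j) =
      (\<Sum>i\<in>G. \<Sum>j\<in>F. ip (bracket i (bracket i j)) j)"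
  proof -
    have "(\<Sum>j\<in>E. ip (bracket i (bracket i j)) j) = 0" if "i \<in> F" for i
      using trace_ad_square[OF E(2) Fn[OF that]] .
    moreover have "(\<Sum>j\<in>G. ip (bracket i (bracket i j)) j) = 0" for i
      using orth[OF br] by simp
    ultimately show ?thesis
      using fin EFG by (simp add: sum.union_disjoint)
  qed
  moreover have "2 * sq G F + 2 * (\<Sum>i\<in>G. \<Sum>j\<in>F. ip (bracket i (bracket i j)) j) =
      (\<Sum>i\<in>G. \<Sum>j\<in>F. \<Sum>k\<in>F. (D i j k + D i k j)\<^sup>2)"
    by (simp add: sq_def sum_distrib_left flip: sym) (simp add: sum.distrib sum_distrib_left)
  moreover have "0 \<le> (\<Sum>i\<in>G. \<Sum>j\<in>F. \<Sum>k\<in>F. (D i j k + D i k j)\<^sup>2)"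
    by (intro sum_nonneg zero_le_power2)
  \<comment> \<open>\<open>bracket_square_sum\<close> now says that \<open>sq F F\<close>,
    \<open>sq G G\<close> and the last sum of squares add up to 0; the two mixed blocks are absorbed
    in that last sum.\<close>
  ultimately have zero: "sq F F = 0" "sq G G = 0"
    "(\<Sum>i\<in>G. \<Sum>j\<in>F. \<Sum>k\<in>F. (D i j k + D i k j)\<^sup>2) = 0"
    using bracket_square_sum[OF E(2)] sq_nonneg[of F F] sq_nonneg[of G G]
    unfolding sq_def[symmetric] by linarith+
  have sq_zero: "bracket e f = 0" if "sq A A = 0" "finite A" "e \<in> A" "f \<in> A" for A e f
    using that by (simp add: sq_def sum_nonneg_eq_0_iff sum_nonneg ip_nonneg ip_self_eq_0)
  show thesis
  proof
    show "onb (F \<union> G) UNIV" "F \<inter> G = {}" "onb F ?n"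
      using E EFG F by auto
    show "bracket e f = 0" if "e \<in> F" "f \<in> F" for e f
      using sq_zero[OF zero(1) fin(2) that] .
    show "bracket e f = 0" if "e \<in> G" "f \<in> G" for e f
      using sq_zero[OF zero(2) fin(3) that] .
    fix a e f assume "a \<in> G" "e \<in> F" "f \<in> F"
    then have "D a e f + D a f e = 0"
      using zero(3) fin by (simp add: sum_nonneg_eq_0_iff sum_nonneg)
    then show "ip (bracket a e) f = - ip e (bracket a f)"
      by (simp add: D_def ip_commute[of e])
  qed
qed

text \<open>Milnor's form of a flat metric Lie algebra, with \<open>p\<close> the orthogonal
  projection onto the derived algebra. The last formula is free of torsion because both summands are
  abelian, and metric because the complement acts by skew maps.\<close>

lemma nabla_decomposition:
  obtains p where "linear p" "\<And>x y. p (bracket x y) = bracket x y"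
    "\<And>x. (\<And>y z. ip x (bracket y z) = 0) \<Longrightarrow> p x = 0"
    "\<And>x y. bracket (x - p x) (y - p y) = 0"
    "\<And>x y. nabla x y = bracket (x - p x) (p y)"
proof -
  obtain F G where E: "onb (F \<union> G) UNIV" and disj: "F \<inter> G = {}"
    and F: "onb F (span (range (\<lambda>(x, y). bracket x y)))"
    and FF: "\<And>e f. e \<in> F \<Longrightarrow> f \<in> F \<Longrightarrow> bracket e f = 0"
    and GG: "\<And>e f. e \<in> G \<Longrightarrow> f \<in> G \<Longrightarrow> bracket e f = 0"
    and skew: "\<And>a e f. a \<in> G \<Longrightarrow> e \<in> F \<Longrightarrow> f \<in> F \<Longrightarrow> ip (bracket a e) f = - ip e (bracket a f)"
    by (rule adapted_onb) (rule that; assumption)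
  have br: "bracket x y \<in> span (range (\<lambda>(x, y). bracket x y))" for x y
    by (rule span_base) auto
  define p where "p x = (\<Sum>e\<in>F. ip x e *\<^sub>R e)" for x
  have q: "x - p x = (\<Sum>e\<in>G. ip x e *\<^sub>R e)" for x
    unfolding p_def by (rule onb_component[OF E refl disj])
  note expand = linear_sum[OF linear_bracket_left] linear_sum[OF linear_bracket_right] bracket_simps
  have lin: "linear p"
    by (simp add: linear_iff p_def ip_simps scaleR_left_distrib sum.distrib scaleR_sum_right)
  have pbr: "p (bracket x y) = bracket x y" for x y
    unfolding p_def by (rule onb_expand[OF F br])
  have psym: "ip (p x) y = ip x (p y)" for x y
    by (simp add: p_def ip_sum_left ip_sum_right ip_simps ip_commute[of _ y] mult.commute)
  have pp: "bracket (p x) (p y) = 0" and qq: "bracket (x - p x) (y - p y) = 0" for x y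
    unfolding q unfolding p_def by (simp_all add: expand FF GG)
  have skew': "ip (bracket (x - p x) (p y)) (p z) = - ip (p y) (bracket (x - p x) (p z))" for x y z
  proof -
    have 1: "ip (bracket a e) (p z) = - ip e (bracket a (p z))" if "a \<in> G" "e \<in> F" for a e
      by (simp add: p_def expand ip_sum_right ip_simps skew[OF that] sum_negf)
    have 2: "ip (bracket a (p y)) v = - ip (p y) w"
      if "\<And>e. e \<in> F \<Longrightarrow> ip (bracket a e) v = - ip e w" for a v w
      by (simp add: p_def expand ip_sum_left ip_simps that sum_negf)
    show ?thesis
      unfolding q by (simp add: expand ip_sum_left ip_sum_right ip_simps 1 2 sum_negf)
  qed
  define L where "L x y = bracket (x - p x) (p y)" for x y
  have "bracket x y = L x y - L y x" for x y
  proof -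
    have "bracket x y = bracket ((x - p x) + p x) ((y - p y) + p y)" by simp
    also have "\<dots> = bracket (x - p x) (p y) + bracket (p x) (y - p y)"
      unfolding bilinear_ladd[OF bilinear_bracket] bilinear_radd[OF bilinear_bracket] pp qq by simp
    finally show ?thesis
      by (simp add: L_def bracket_anticommute[of "p x" "y - p y"])
  qed
  moreover have "ip (L x y) z = - ip y (L x z)" for x y z
    using skew'[of x y z] psym[of "L x y" z] psym[of y "L x z"] by (simp add: L_def pbr)
  ultimately have nab: "nabla x y = L x y" for x y
    by (intro nabla_unique) auto
  show thesis
  proof
    show "p x = 0" if "\<And>y z. ip x (bracket y z) = 0" for x
    proof -
      have "ip (p x) (p x) = ip x (p (p x))" by (rule psym)
      moreover have "ip x v = 0" if "v \<in> span (range (\<lambda>(x, y). bracket x y))" for v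
        using that by (induction rule: span_induct_alt) (use \<open>\<And>y z. ip x (bracket y z) = 0\<close> in \<open>auto simp: ip_simps\<close>)
      moreover have "p y \<in> span (range (\<lambda>(x, y). bracket x y))" for y
        using F unfolding p_def onb_def by (metis (no_types, lifting) span_base span_scale span_sum)
      ultimately show ?thesis
        using ip_self_eq_0 by metis
    qed
  qed (use lin pbr qq nab in \<open>auto simp: L_def\<close>)
qed

end

section \<open>Transversely Kaehler Lie algebras\<close>

text \<open>The common feature of the two geometries: \<open>\<phi>\<close> is the transverse complex structure, extended
  by 0. In the Sasakian case its kernel is spanned by the Reeb vector \<open>\<xi>\<close>; in the Vaisman case the
  kernel also contains the dual of the Lee form.\<close>

locale transverse_kaehler = metric_lie_algebra bracket ip
  for bracket :: "'a::real_vector \<Rightarrow> 'a \<Rightarrow> 'a" and ip :: "'a \<Rightarrow> 'a \<Rightarrow> real" +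
  fixes \<phi> :: "'a \<Rightarrow> 'a" and \<xi> :: 'a
  assumes linear_\<phi>: "linear \<phi>"
    and \<phi>_skew: "ip (\<phi> x) y = - ip x (\<phi> y)"
    and \<phi>_cube: "\<phi> (\<phi> (\<phi> x)) = - \<phi> x"
    and \<phi>_\<xi>: "\<phi> \<xi> = 0"
    and \<xi>_nonzero: "\<xi> \<noteq> 0"
    and bracket_split: "bracket x y = ip (\<phi> x) y *\<^sub>R \<xi> - \<phi> (\<phi> (bracket x y))"
    and integrable: "\<phi> (\<phi> (bracket (\<phi> x) (\<phi> y) - bracket x y))
      + \<phi> (bracket (\<phi> x) y + bracket x (\<phi> y)) = 0"
    and unimodular: "unimodular bracket"
    and solvable: "solvable_lie bracket"
begin

lemmas \<phi>_simps = linear_add[OF linear_\<phi>] linear_diff[OF linear_\<phi>] linear_neg[OF linear_\<phi>]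
  linear_cmul[OF linear_\<phi>] linear_0[OF linear_\<phi>] linear_sum[OF linear_\<phi>]

lemma ip_\<phi>_\<xi>: "ip (\<phi> x) \<xi> = 0" "ip \<xi> (\<phi> x) = 0"
  using \<phi>_skew[of x \<xi>] ip_commute[of \<xi> "\<phi> x"] by (simp_all add: \<phi>_\<xi> ip_simps)

lemma \<phi>_sq_bracket: "\<phi> (\<phi> (bracket x y)) = ip (\<phi> x) y *\<^sub>R \<xi> - bracket x y"
  using bracket_split[of x y] by (simp only: eq_diff_eq add.commute)

lemma ip_bracket_\<xi>: "ip (bracket x y) \<xi> = ip (\<phi> x) y * ip \<xi> \<xi>"
  by (subst bracket_split) (simp add: ip_simps ip_\<phi>_\<xi>)

text \<open>The \<open>\<xi>\<close>-component of the Jacobi identity, since the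
  \<open>\<xi>\<close>-component of a bracket is the transverse form up to scale.\<close>

lemma transverse_form_closed: "ip (\<phi> x) (bracket y z) + ip (\<phi> y) (bracket z x) + ip (\<phi> z) (bracket x y) = 0"
proof -
  have "(ip (\<phi> x) (bracket y z) + ip (\<phi> y) (bracket z x) + ip (\<phi> z) (bracket x y)) * ip \<xi> \<xi> =
      ip (bracket x (bracket y z) + bracket y (bracket z x) + bracket z (bracket x y)) \<xi>"
    by (simp add: ip_simps ip_bracket_\<xi> distrib_right)
  then show ?thesis
    using \<xi>_nonzero by (simp add: jacobi ip_simps ip_self_eq_0)
qed

lemma trace_ad:
  assumes "onb E UNIV"
  shows "(\<Sum>e\<in>E. ip (bracket x e) e) = 0"
  using unimodular lin_trace_onb[OF linear_bracket_right assms] by (simp add: unimodular_def)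

text \<open>Unimodularity makes the horizontal part of \<open>\<Sum>[e, \<phi> e]\<close> vanish, which exhibits \<open>\<xi>\<close> as a
  sum of brackets.\<close>

lemma \<phi>_sum_bracket_\<phi>:
  assumes E: "onb E UNIV"
  shows "\<phi> (\<Sum>e\<in>E. bracket e (\<phi> e)) = 0"
proof (rule ip_eqI)
  fix z
  have 1: "(\<Sum>e\<in>E. ip (\<phi> e) (bracket (\<phi> e) z)) = (\<Sum>e\<in>E. ip (\<phi> (\<phi> e)) (bracket z e))"
  proof -
    have "bilinear (\<lambda>x y. ip (\<phi> y) (bracket x z))"
      by (simp add: bilinear_def linear_iff ip_simps bracket_simps \<phi>_simps)
    from sum_onb_skew[OF E this \<phi>_skew] show ?thesis
      by (simp add: bracket_anticommute[of z] ip_simps sum_negf)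
  qed
  have 2: "(\<Sum>e\<in>E. ip (\<phi> (\<phi> e)) (bracket z e)) = 0"
  proof -
    have "ip (\<phi> (\<phi> e)) (bracket z e) = ip (\<phi> z) e * ip \<xi> e - ip (bracket z e) e" for e
    proof -
      have "ip (\<phi> (\<phi> e)) (bracket z e) = ip e (\<phi> (\<phi> (bracket z e)))"
        by (simp add: \<phi>_skew)
      then show ?thesis
        by (simp add: \<phi>_sq_bracket ip_simps ip_commute[of e])
    qed
    then show ?thesis
      using onb_parseval[OF E, of "\<phi> z" \<xi>] trace_ad[OF E, of z]
      by (simp add: sum_subtractf ip_\<phi>_\<xi>)
  qed
  have "ip (\<phi> e) (bracket (\<phi> e) z) + ip (\<phi> (\<phi> e)) (bracket z e) + ip (\<phi> z) (bracket e (\<phi> e)) = 0" for e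
    using transverse_form_closed[of e "\<phi> e" z] .
  then have "(\<Sum>e\<in>E. ip (\<phi> e) (bracket (\<phi> e) z)) + (\<Sum>e\<in>E. ip (\<phi> (\<phi> e)) (bracket z e))
      + ip (\<phi> z) (\<Sum>e\<in>E. bracket e (\<phi> e)) = 0"
    by (simp add: ip_sum_right flip: sum.distrib)
  then have "ip (\<phi> z) (\<Sum>e\<in>E. bracket e (\<phi> e)) = 0"
    using 1 2 by simp
  then show "ip (\<phi> (\<Sum>e\<in>E. bracket e (\<phi> e))) z = ip 0 z"
    by (simp add: \<phi>_skew[of "sum _ _"] ip_commute[of _ "\<phi> z"] ip_simps)
qed

lemma \<xi>_in_derived:
  assumes "\<phi> x \<noteq> 0"
  shows "\<xi> \<in> derived_series bracket (Suc 0)"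
proof -
  obtain E where E: "onb E UNIV" using onb_exists[OF subspace_UNIV] by auto
  define S where "S = (\<Sum>e\<in>E. bracket e (\<phi> e))"
  define c where "c = (\<Sum>e\<in>E. ip (\<phi> e) (\<phi> e))"
  have "S = (\<Sum>e\<in>E. ip (\<phi> e) (\<phi> e) *\<^sub>R \<xi> - \<phi> (\<phi> (bracket e (\<phi> e))))"
    unfolding S_def by (rule sum.cong[OF refl bracket_split])
  also have "\<dots> = c *\<^sub>R \<xi> - \<phi> (\<phi> S)"
    by (simp add: sum_subtractf c_def S_def \<phi>_simps scaleR_sum_left)
  finally have S: "S = c *\<^sub>R \<xi>"
    using \<phi>_sum_bracket_\<phi>[OF E, folded S_def] by (simp add: \<phi>_simps(5))
  \<comment> \<open>\<open>c\<close> is the squared Hilbert-Schmidt norm of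
    \<open>\<phi>\<close>.\<close>
  have "c \<noteq> 0"
  proof
    assume "c = 0"
    then have "\<phi> e = 0" if "e \<in> E" for e
      using E that by (simp add: c_def sum_nonneg_eq_0_iff ip_nonneg ip_self_eq_0 onb_def orthonormal_def)
    then have "\<phi> (\<Sum>e\<in>E. ip x e *\<^sub>R e) = 0"
      by (simp add: \<phi>_simps)
    then show False
      using onb_expand[OF E, of x] assms by simp
  qed
  then have "\<xi> = (1 / c) *\<^sub>R S"
    by (simp add: S)
  moreover have "S \<in> derived_series bracket (Suc 0)"
    unfolding S_def derived_series.simps by (rule span_sum, rule span_base) blast
  ultimately show ?thesis
    using subspace_scale[OF subspace_derived_series] by metis
qed

section \<open>Centrality of \<open>\<xi>\<close>\<close>

lemma bracket_\<xi>_horizontal: "\<phi> (\<phi> (bracket \<xi> x)) = - bracket \<xi> x"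
  by (simp add: \<phi>_sq_bracket \<phi>_\<xi> ip_simps)

lemma bracket_\<xi>_\<phi>: "bracket \<xi> (\<phi> x) = \<phi> (bracket \<xi> x)"
proof -
  have "\<phi> (bracket \<xi> (\<phi> x)) = - bracket \<xi> x"
    using integrable[of \<xi> x] by (simp add: \<phi>_\<xi> \<phi>_simps bracket_simps bracket_\<xi>_horizontal eq_neg_iff_add_eq_0 add.commute)
  then have "\<phi> (\<phi> (bracket \<xi> (\<phi> x))) = - \<phi> (bracket \<xi> x)"
    by (simp add: \<phi>_simps)
  then show ?thesis
    using bracket_\<xi>_horizontal[of "\<phi> x"] by simp
qed

text \<open>By closedness \<open>ad \<xi>\<close> preserves the transverse form, and it commutes
  with \<open>\<phi>\<close>; so it preserves the metric on the image of \<open>\<phi>\<close>. On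
  the kernel of \<open>\<phi>\<close> it is 0.\<close>

lemma bracket_\<xi>_skew: "ip (bracket \<xi> x) y = - ip x (bracket \<xi> y)"
proof -
  have *: "ip (bracket \<xi> (\<phi> u)) v = - ip (\<phi> u) (bracket \<xi> v)" for u v
    using transverse_form_closed[of \<xi> u v] bracket_anticommute[of v \<xi>]
    by (simp add: \<phi>_\<xi> ip_simps bracket_\<xi>_\<phi> \<phi>_skew[of _ v] ip_commute[of "\<phi> v"])
  have "ip (bracket \<xi> x) y = - ip (bracket \<xi> (\<phi> (\<phi> x))) y"
    using bracket_\<xi>_horizontal[of x] by (simp add: bracket_\<xi>_\<phi> ip_simps)
  also have "\<dots> = ip (\<phi> (\<phi> x)) (bracket \<xi> y)"
    by (simp add: *)
  also have "\<dots> = ip x (\<phi> (\<phi> (bracket \<xi> y)))"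
    by (simp add: \<phi>_skew)
  finally show ?thesis
    by (simp add: bracket_\<xi>_horizontal ip_simps)
qed

lemma \<xi>_central: "bracket \<xi> x = 0"
proof (cases "\<exists>x. \<phi> x \<noteq> 0")
  case True
  obtain E where E: "onb E UNIV" using onb_exists[OF subspace_UNIV] by auto
  have "(\<Sum>e\<in>E. ip (bracket \<xi> (bracket \<xi> e)) e) = 0"
    using trace_square_derived[OF solvable _ E] \<xi>_in_derived True by blast
  then have "(\<Sum>e\<in>E. ip (bracket \<xi> e) (bracket \<xi> e)) = 0"
    by (simp add: bracket_\<xi>_skew[of "bracket \<xi> _"] sum_negf)
  then have "bracket \<xi> e = 0" if "e \<in> E" for e
    using E that by (simp add: sum_nonneg_eq_0_iff ip_nonneg ip_self_eq_0 onb_def orthonormal_def)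
  then have "bracket \<xi> (\<Sum>e\<in>E. ip x e *\<^sub>R e) = 0"
    by (simp add: linear_sum[OF linear_bracket_right] bracket_simps)
  then show ?thesis
    using onb_expand[OF E, of x] by simp
next
  case False
  then show ?thesis
    using bracket_\<xi>_horizontal[of x] by simp
qed

lemma \<xi>_central': "bracket x \<xi> = 0"
  using bracket_anticommute[of x \<xi>] by (simp add: \<xi>_central)

text \<open>The bracket of the quotient by the line of \<open>\<xi>\<close>, kept on the whole space
  with \<open>\<xi>\<close> as a central direction; the term subtracted is the cocycle of the
  extension.\<close>

definition hbracket :: "'a \<Rightarrow> 'a \<Rightarrow> 'a" where
  "hbracket x y = bracket x y - ip (\<phi> x) y *\<^sub>R \<xi>"

lemma hbracket_eq: "hbracket x y = - \<phi> (\<phi> (bracket x y))"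
  by (simp add: hbracket_def \<phi>_sq_bracket)

lemma \<phi>_sq_hbracket: "\<phi> (\<phi> (hbracket x y)) = - hbracket x y"
  by (simp add: hbracket_eq \<phi>_simps \<phi>_cube)

lemma \<phi>_hbracket: "\<phi> (hbracket x y) = \<phi> (bracket x y)"
  by (simp add: hbracket_eq \<phi>_simps \<phi>_cube)

lemma ip_\<phi>_hbracket: "ip (\<phi> z) (hbracket x y) = ip (\<phi> z) (bracket x y)"
  by (simp add: hbracket_def ip_simps ip_\<phi>_\<xi>)

lemma hbracket_\<xi>: "hbracket \<xi> x = 0" "hbracket x \<xi> = 0"
  by (simp_all add: hbracket_def \<xi>_central \<xi>_central' \<phi>_\<xi> ip_\<phi>_\<xi> ip_simps)

lemma bracket_hbracket: "bracket x (hbracket y z) = bracket x (bracket y z)"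
  by (simp add: hbracket_def bracket_simps \<xi>_central')

lemma hbracket_integrable:
  "hbracket (\<phi> x) (\<phi> y) - hbracket x y = \<phi> (hbracket (\<phi> x) y + hbracket x (\<phi> y))"
  using integrable[of x y] by (simp add: \<phi>_hbracket \<phi>_simps) (simp add: hbracket_eq algebra_simps)

sublocale h: metric_lie_algebra hbracket ip
proof unfold_locales
  show "\<exists>B::'a set. finite B \<and> span B = UNIV" by (rule finite_dimensional)
  show "bilinear hbracket"
    by (simp add: bilinear_def linear_iff hbracket_eq bracket_simps \<phi>_simps)
  show "hbracket x x = 0" for x
    by (simp add: hbracket_eq bracket_self \<phi>_simps)
  show "hbracket x (hbracket y z) + hbracket y (hbracket z x) + hbracket z (hbracket x y) = 0" for x y z
  proof -
    have "hbracket x (hbracket y z) + hbracket y (hbracket z x) + hbracket z (hbracket x y) =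
        - \<phi> (\<phi> (bracket x (bracket y z) + bracket y (bracket z x) + bracket z (bracket x y)))"
      unfolding hbracket_eq[of _ "hbracket _ _"] bracket_hbracket by (simp add: \<phi>_simps)
    then show ?thesis by (simp add: jacobi \<phi>_simps)
  qed
qed

lemma ip_hbracket_\<phi>_\<phi>: "ip (\<phi> (\<phi> z)) (hbracket x y) = - ip z (hbracket x y)"
  by (simp add: \<phi>_skew \<phi>_sq_hbracket ip_simps)

lemma hclosed: "ip (\<phi> x) (hbracket y z) + ip (\<phi> y) (hbracket z x) + ip (\<phi> z) (hbracket x y) = 0"
  unfolding ip_\<phi>_hbracket by (rule transverse_form_closed)

text \<open>As for Kaehler manifolds, the derivative of \<open>\<phi>\<close> is a combination of
  the differential of the transverse form at (x, y, z) and (x, \<open>\<phi>\<close> y,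
  \<open>\<phi>\<close> z) and of the Nijenhuis tensor paired with \<open>\<phi>\<close> x: facts 1,
  2 and 3.\<close>

lemma hnabla_\<phi>: "h.nabla x (\<phi> y) = \<phi> (h.nabla x y)"
proof (rule ip_eqI)
  fix z
  have 1: "ip (\<phi> x) (hbracket y z) + ip (\<phi> y) (hbracket z x) + ip (\<phi> z) (hbracket x y) = 0"
    by (rule hclosed)
  have 2: "ip (\<phi> x) (hbracket (\<phi> y) (\<phi> z)) - ip y (hbracket (\<phi> z) x) - ip z (hbracket x (\<phi> y)) = 0"
    using hclosed[of x "\<phi> y" "\<phi> z"] by (simp add: ip_hbracket_\<phi>_\<phi>)
  have 3: "ip (\<phi> x) (hbracket (\<phi> y) (\<phi> z)) - ip (\<phi> x) (hbracket y z) =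
      ip x (hbracket (\<phi> y) z) + ip x (hbracket y (\<phi> z))"
    using arg_cong[OF hbracket_integrable[of y z], of "ip (\<phi> x)"]
    by (simp add: ip_simps \<phi>_simps \<phi>_skew[of x "\<phi> _"] \<phi>_sq_hbracket)
  have "ip (h.nabla x (\<phi> y)) z = - ip (h.nabla x y) (\<phi> z)"
    unfolding h.koszul using 1 2 3
    by (simp add: ip_commute[of "hbracket _ _"] field_simps)
  then show "ip (h.nabla x (\<phi> y)) z = ip (\<phi> (h.nabla x y)) z"
    by (simp add: \<phi>_skew)
qed

text \<open>The argument for \<open>ad \<xi>\<close> again, now for vectors that need not be
  central, such as the dual of the Lee form.\<close>

lemma hbracket_kernel_skew:
  assumes k: "\<phi> k = 0"
  shows "ip (hbracket k x) y = - ip x (hbracket k y)"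
proof -
  have "\<phi> (hbracket k (\<phi> z)) = - hbracket k z" for z
    using hbracket_integrable[of k z] k by (simp add: h.bracket_simps)
  then have comm: "hbracket k (\<phi> z) = \<phi> (hbracket k z)" for z
    using \<phi>_sq_hbracket[of k "\<phi> z"] by (simp add: \<phi>_simps)
  have "ip (\<phi> (\<phi> x)) (hbracket y k) + ip (\<phi> y) (hbracket k (\<phi> x)) = 0"
    using hclosed[of k "\<phi> x" y] k by (simp add: ip_simps)
  then have "- ip x (hbracket y k) + ip y (hbracket k x) = 0"
    by (simp add: ip_hbracket_\<phi>_\<phi> comm \<phi>_skew[of y] \<phi>_sq_hbracket ip_simps)
  then show ?thesis
    by (simp add: h.bracket_anticommute[of y k] ip_simps ip_commute[of y])
qed

lemma \<phi>_sq_eq_if_orthogonal: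
  assumes "\<And>k. \<phi> k = 0 \<Longrightarrow> ip v k = 0"
  shows "\<phi> (\<phi> v) = - v"
proof -
  \<comment> \<open>The orthogonal projection of \<open>v\<close> onto the kernel of
    \<open>\<phi>\<close>.\<close>
  define k where "k = v + \<phi> (\<phi> v)"
  have k: "\<phi> k = 0"
    by (simp add: k_def \<phi>_simps \<phi>_cube)
  have "ip k k = ip v k + ip v (\<phi> (\<phi> k))"
    by (subst (1) k_def) (simp add: ip_simps \<phi>_skew)
  then have "k = 0"
    using assms[OF k] by (simp add: k \<phi>_simps ip_simps ip_self_eq_0)
  then show ?thesis
    by (simp add: k_def eq_neg_iff_add_eq_0 add.commute)
qed

text \<open>Paired with a kernel vector, the Koszul formula loses its first term because
  \<open>hbracket\<close> takes values orthogonal to the kernel; the other two cancel by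
  skewness.\<close>

lemma \<phi>_sq_hnabla: "\<phi> (\<phi> (h.nabla x y)) = - h.nabla x y"
proof (rule \<phi>_sq_eq_if_orthogonal)
  fix k assume k: "\<phi> k = 0"
  have "ip (hbracket x y) k = 0"
    using ip_hbracket_\<phi>_\<phi>[of k x y] k by (simp add: \<phi>_simps ip_simps ip_commute[of k])
  then show "ip (h.nabla x y) k = 0"
    using hbracket_kernel_skew[OF k, of x y] h.bracket_anticommute[of y k]
    by (simp add: h.koszul ip_simps ip_commute[of x])
qed

text \<open>Carries Cartan's criterion over to \<open>hbracket\<close>: the shift along the central
  \<open>\<xi>\<close> does not change the adjoint map.\<close>

lemma hderived:
  "v \<in> span (range (\<lambda>(x, y). hbracket x y)) \<Longrightarrow> \<exists>c. v + c *\<^sub>R \<xi> \<in> derived_series bracket (Suc 0)"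
proof (induction rule: span_induct_alt)
  case base
  show ?case
    using subspace_0[OF subspace_derived_series] by (metis add.left_neutral scaleR_zero_left)
next
  case (step r u w)
  then obtain x y c where u: "u = hbracket x y" and c: "w + c *\<^sub>R \<xi> \<in> derived_series bracket (Suc 0)"
    by auto
  have "bracket x y \<in> derived_series bracket (Suc 0)"
    by (auto intro: span_base)
  then have "r *\<^sub>R bracket x y + (w + c *\<^sub>R \<xi>) \<in> derived_series bracket (Suc 0)"
    using c subspace_add[OF subspace_derived_series] subspace_scale[OF subspace_derived_series] by blast
  also have "r *\<^sub>R bracket x y + (w + c *\<^sub>R \<xi>) = (r *\<^sub>R u + w) + (r * ip (\<phi> x) y + c) *\<^sub>R \<xi>"
    by (simp add: u hbracket_def algebra_simps)
  finally show ?case by blast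
qed

sublocale h: unimodular_parallel hbracket ip \<phi>
proof unfold_locales
  fix E assume E: "onb E UNIV"
  show "(\<Sum>e\<in>E. ip (hbracket x e) e) = 0" for x
    using trace_ad[OF E, of x] onb_parseval[OF E, of "\<phi> x" \<xi>]
    by (simp add: hbracket_def ip_simps sum_subtractf ip_\<phi>_\<xi>)
  fix v assume "v \<in> span (range (\<lambda>(x, y). hbracket x y))"
  then obtain c where c: "v + c *\<^sub>R \<xi> \<in> derived_series bracket (Suc 0)"
    using hderived by blast
  have "ip (hbracket v (hbracket v e)) e =
      ip (bracket (v + c *\<^sub>R \<xi>) (bracket (v + c *\<^sub>R \<xi>) e)) e - ip \<xi> e * ip (\<phi> v) (hbracket v e)" for e
    unfolding hbracket_def[of v "hbracket v e"] bracket_hbracket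
    by (simp add: ip_simps bracket_simps \<xi>_central)
  then have "(\<Sum>e\<in>E. ip (hbracket v (hbracket v e)) e) =
      - (\<Sum>e\<in>E. ip \<xi> e * ip (\<phi> v) (hbracket v e))"
    using trace_square_derived[OF solvable c E] by (simp add: sum_subtractf)
  also have "(\<Sum>e\<in>E. ip \<xi> e * ip (\<phi> v) (hbracket v e)) =
      ip (\<phi> v) (hbracket v (\<Sum>e\<in>E. ip \<xi> e *\<^sub>R e))"
    by (simp add: linear_sum[OF h.linear_bracket_right] h.bracket_simps ip_sum_right ip_simps)
  finally show "(\<Sum>e\<in>E. ip (hbracket v (hbracket v e)) e) = 0"
    using onb_expand[OF E, of \<xi>] by (simp add: hbracket_\<xi> ip_simps)
qed (simp_all add: \<phi>_simps \<phi>_skew hnabla_\<phi> \<phi>_sq_hnabla)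

text \<open>The flat connection \<open>L\<close> satisfies \<open>LL\<close> and
  \<open>Lcomm\<close>, so left symmetry concerns only the \<open>\<xi>\<close>-component of the
  associator. By \<open>L\<phi>\<close>, parallelism of the cocycle, that component is symmetric in
  its first two arguments.\<close>

theorem complete_lsa_exists: "\<exists>prd. lsa_structure bracket prd \<and> complete_lsa prd"
proof -
  obtain p where p: "linear p" and pbr: "\<And>x y. p (hbracket x y) = hbracket x y"
    and pker: "\<And>x. (\<And>y z. ip x (hbracket y z) = 0) \<Longrightarrow> p x = 0"
    and qq: "\<And>x y. hbracket (x - p x) (y - p y) = 0"
    and nab: "\<And>x y. h.nabla x y = hbracket (x - p x) (p y)"
    using h.nabla_decomposition by blast
  note p_simps = linear_add[OF p] linear_cmul[OF p] linear_0[OF p]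
  define L where "L x y = h.nabla x y" for x y
  have L: "L x y = hbracket (x - p x) (p y)" for x y
    by (simp add: L_def nab)
  have bilL: "bilinear L"
    unfolding L_def by (rule h.bilinear_nabla)
  note L_simps = bilinear_ladd[OF bilL] bilinear_radd[OF bilL]
    bilinear_lmul[OF bilL] bilinear_rmul[OF bilL] 
  have p\<xi>: "p \<xi> = 0"
    by (rule pker) (simp add: hbracket_eq ip_simps ip_\<phi>_\<xi>)
  have L\<xi>: "L x \<xi> = 0" "L \<xi> x = 0" for x
    by (simp_all add: L p\<xi> h.bracket_simps hbracket_\<xi>)
  have pL: "p (L x y) = L x y" for x y
    by (simp add: L pbr)
  have LL: "L (L x y) z = 0" for x y z
    unfolding L[of "L x y"] pL by (simp add: h.bracket_simps)
  have Lcomm: "L x (L y z) = L y (L x z)" for x y z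
    using h.bracket_derivation[of "x - p x" "y - p y" "p z"]
    unfolding L pbr qq by (simp add: h.bracket_simps)
  have L\<phi>: "ip (\<phi> x) (L y z) = - ip (\<phi> (L y x)) z" for x y z
    using h.nabla_metric[of y "\<phi> x" z] by (simp add: L_def hnabla_\<phi>)
  define prd where "prd x y = L x y + (ip (\<phi> x) y / 2) *\<^sub>R \<xi>" for x y
  have bil: "bilinear prd"
    by (simp add: bilinear_def linear_iff prd_def L_simps ip_simps \<phi>_simps algebra_simps
        add_divide_distrib)
  moreover have "bracket x y = prd x y - prd y x" for x y
  proof -
    have "prd x y - prd y x = hbracket x y + (ip (\<phi> x) y / 2 - ip (\<phi> y) x / 2) *\<^sub>R \<xi>"
      by (simp add: prd_def L_def algebra_simps flip: h.nabla_torsion_free)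
    also have "ip (\<phi> x) y / 2 - ip (\<phi> y) x / 2 = ip (\<phi> x) y"
      by (simp add: \<phi>_skew[of y] ip_commute[of y])
    finally show ?thesis
      by (simp add: hbracket_def)
  qed
  moreover have "prd x (prd y z) - prd (prd x y) z = prd y (prd x z) - prd (prd y x) z" for x y z
  proof -
    have "prd x (prd y z) - prd (prd x y) z =
        L x (L y z) + ((ip (\<phi> x) (L y z) - ip (\<phi> (L x y)) z) / 2) *\<^sub>R \<xi>" for x y
      by (simp add: prd_def L_simps L\<xi> LL ip_simps ip_\<phi>_\<xi> \<phi>_simps \<phi>_\<xi> algebra_simps diff_divide_distrib)
    then show ?thesis
      by (simp add: L\<phi> Lcomm[of x])
  qed
  ultimately have "lsa_structure bracket prd"
    by (simp add: lsa_structure_def)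
  moreover have "bij (\<lambda>y. y + prd y x)" for x
  proof -
    have lin: "linear (\<lambda>y. y + prd y x)"
      using bil by (simp add: bilinear_def linear_iff algebra_simps)
    have inj: "y = 0" if y: "y + prd y x = 0" for y
    proof -
      define c where "c = ip (\<phi> y) x / 2"
      have y0: "y + L y x + c *\<^sub>R \<xi> = 0"
        using y by (simp add: prd_def c_def add.assoc)
      \<comment> \<open>\<open>p\<close> isolates the derived part. The rest of \<open>y\<close> is
        a multiple of \<open>\<xi>\<close>, so \<open>L y x\<close> vanishes; then \<open>y\<close>
        itself is such a multiple and \<open>c\<close>, computed from \<open>\<phi> y\<close>, is
        0.\<close>
      then have "p (y + L y x + c *\<^sub>R \<xi>) = 0"
        by (simp add: p_simps)
      then have "p y + L y x = 0"
        by (simp add: p_simps pL p\<xi>)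
      then have "y - p y + c *\<^sub>R \<xi> = 0"
        using y0 by (simp add: algebra_simps) (metis add.left_commute add_cancel_right_right add.commute)
      then have "y - p y = - c *\<^sub>R \<xi>"
        by (simp add: eq_neg_iff_add_eq_0)
      then have "L y x = 0"
        by (simp only: L h.bracket_simps hbracket_\<xi> scaleR_zero_right)
      then have yc: "y = - c *\<^sub>R \<xi>"
        using y0 by (simp add: eq_neg_iff_add_eq_0)
      have "\<phi> y = 0"
        by (subst yc) (simp add: \<phi>_simps \<phi>_\<xi>)
      then have "c = 0"
        by (simp add: c_def ip_simps)
      then show ?thesis using yc by simp
    qed
    have "surj (\<lambda>y. y + prd y x)"
      by (rule linear_inj_on_surj[OF lin subspace_UNIV UNIV_I inj])
    moreover have "inj (\<lambda>y. y + prd y x)"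
      unfolding linear_inj_iff_eq_0[OF lin] using inj by blast
    ultimately show ?thesis
      by (rule bijI[rotated])
  qed
  ultimately show ?thesis
    by (auto simp: complete_lsa_def)
qed

end

section \<open>Sasakian and Vaisman structures\<close>

text \<open>The axiom for \<open>\<phi> (\<phi> x)\<close> splits off the
  \<open>\<xi>\<close>-component, which the contact condition computes for a bracket. In the
  normality condition the \<open>\<xi>\<close>-terms of the two sides cancel.\<close>

lemma sasakian_transverse_kaehler:
  assumes "fd_lie_algebra bracket" "unimodular bracket" "solvable_lie bracket"
    and sas: "sasakian_structure bracket ip \<phi> \<xi> \<eta>"
  shows "transverse_kaehler bracket ip \<phi> \<xi>"
proof -
  interpret fd_lie_algebra bracket by fact
  have ip: "inner_product ip" and lin: "linear \<phi>" "linear \<eta>" and \<eta>\<xi>: "\<eta> \<xi> = 1"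
    and sq: "\<And>x. \<phi> (\<phi> x) = - x + \<eta> x *\<^sub>R \<xi>"
    and compat: "\<And>x y. ip (\<phi> x) (\<phi> y) = ip x y - \<eta> x * \<eta> y"
    and contact: "\<And>x y. \<eta> (bracket x y) = ip (\<phi> x) y"
    and nijenhuis: "\<And>x y. bracket (\<phi> x) (\<phi> y) + \<phi> (\<phi> (bracket x y))
      - \<phi> (bracket (\<phi> x) y + bracket x (\<phi> y)) = \<eta> (bracket x y) *\<^sub>R \<xi>"
    using sas by (auto simp: sasakian_structure_def almost_contact_metric_def nijenhuis_phi_def
        ce_diff1_def)
  interpret fd_inner_product ip
    using finite_dimensional ip by unfold_locales
  note \<phi>_simps = linear_add[OF lin(1)] linear_diff[OF lin(1)] linear_neg[OF lin(1)]
    linear_cmul[OF lin(1)] linear_0[OF lin(1)]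
  have \<phi>\<xi>: "\<phi> \<xi> = 0"
  proof -
    have "\<phi> (\<phi> \<xi>) = 0"
      using sq[of \<xi>] by (simp add: \<eta>\<xi>)
    \<comment> \<open>So \<open>\<phi> \<xi>\<close> is a multiple of \<open>\<xi>\<close>; applying
      \<open>\<phi>\<close> shows that the factor or \<open>\<phi> \<xi>\<close> is 0, and both give
      the claim.\<close>
    then have "\<phi> \<xi> = \<eta> (\<phi> \<xi>) *\<^sub>R \<xi>"
      using sq[of "\<phi> \<xi>"] by (simp add: \<phi>_simps)
    then show ?thesis
      using \<open>\<phi> (\<phi> \<xi>) = 0\<close> \<eta>\<xi> linear_0[OF lin(2)]
      by (metis (full_types) \<phi>_simps(4) scaleR_eq_0_iff zero_neq_one)
  qed
  have \<xi>: "\<xi> \<noteq> 0"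
    using \<eta>\<xi> linear_0[OF lin(2)] by auto
  have \<phi>_cube: "\<phi> (\<phi> (\<phi> x)) = - \<phi> x" for x
    by (simp only: sq[of x] \<phi>_simps \<phi>\<xi>) simp
  have \<eta>\<phi>: "\<eta> (\<phi> x) = 0" for x
    using sq[of "\<phi> x"] \<phi>_cube[of x] \<xi> by simp
  have ip\<xi>: "ip x \<xi> = \<eta> x" for x
    using compat[of x \<xi>] by (simp add: \<phi>\<xi> \<eta>\<xi> ip_simps)
  have skew: "ip (\<phi> x) y = - ip x (\<phi> y)" for x y
    using compat[of x "\<phi> y"] by (simp add: sq[of y] \<eta>\<phi> ip_simps ip\<xi>)
  show ?thesis
  proof unfold_locales
    fix x y
    show "bracket x y = ip (\<phi> x) y *\<^sub>R \<xi> - \<phi> (\<phi> (bracket x y))"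
      by (simp add: sq contact)
    have "bracket (\<phi> x) (\<phi> y) - bracket x y - \<phi> (bracket (\<phi> x) y + bracket x (\<phi> y)) = 0"
      using nijenhuis[of x y] by (simp add: sq[of "bracket x y"])
    then have "bracket (\<phi> x) (\<phi> y) - bracket x y = \<phi> (bracket (\<phi> x) y + bracket x (\<phi> y))"
      by simp
    then show "\<phi> (\<phi> (bracket (\<phi> x) (\<phi> y) - bracket x y))
      + \<phi> (bracket (\<phi> x) y + bracket x (\<phi> y)) = 0"
      by (simp only: \<phi>_cube) simp
  qed (use \<phi>_cube \<phi>\<xi> \<xi> skew assms in \<open>simp_all add: \<phi>_simps\<close>)
qed

text \<open>The vector \<open>\<xi>\<close> is the image under \<open>J\<close> of the dual \<open>A\<close> of the Lee form, and \<open>\<phi>\<close> is \<open>J\<close> on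
  the orthogonal complement of \<open>A\<close> and \<open>\<xi>\<close>, extended by 0.\<close>

lemma vaisman_transverse_kaehler:
  assumes "fd_lie_algebra bracket" "unimodular bracket" "solvable_lie bracket"
    and vaisman: "vaisman_structure bracket J ip"
  shows "\<exists>\<phi> \<xi>. transverse_kaehler bracket ip \<phi> \<xi>"
proof -
  interpret fd_lie_algebra bracket by fact
  obtain \<theta> where lck: "lck_with_lee_form bracket J ip \<theta>" and \<theta>0: "\<exists>x. \<theta> x \<noteq> 0"
    and par: "\<And>x y. \<theta> (levi_civita bracket ip x y) = 0"
    using vaisman by (auto simp: vaisman_structure_def)
  have linJ: "linear J" and JJ: "\<And>x. J (J x) = - x"
    and nij: "\<And>x y. bracket (J x) (J y) - bracket x y - J (bracket (J x) y + bracket x (J y)) = 0"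
    and ip: "inner_product ip" and herm: "\<And>x y. ip (J x) (J y) = ip x y"
    and lin\<theta>: "linear \<theta>" and \<theta>br: "\<And>x y. \<theta> (bracket x y) = 0"
    and d\<omega>': "\<And>x y z. - ip (J (bracket x y)) z - ip (J (bracket y z)) x - ip (J (bracket z x)) y
        = \<theta> x * ip (J y) z + \<theta> y * ip (J z) x + \<theta> z * ip (J x) y"
    using lck by (auto simp: lck_with_lee_form_def hermitian_structure_def complex_structure_def
        ce_diff1_def ce_diff2_def fundamental_form_def wedge12_def)
  interpret metric_lie_algebra bracket ip
    using finite_dimensional ip by unfold_locales
  note J_simps = linear_add[OF linJ] linear_diff[OF linJ] linear_neg[OF linJ]
    linear_cmul[OF linJ] linear_0[OF linJ]
  have Jskew: "ip (J x) y = - ip x (J y)" for x y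
    using herm[of x "J y"] by (simp add: JJ ip_simps)
  obtain A where A: "\<And>x. ip A x = \<theta> x"
    using inner_product_riesz[OF finite_dimensional ip lin\<theta>] by blast
  define a where "a = ip A A"
  have A0: "A \<noteq> 0"
    using \<theta>0 A by (metis bilinear_lzero[OF bilinear_ip])
  then have a0: "a \<noteq> 0"
    by (simp add: a_def ip_self_eq_0)
  define Z where "Z = J A"
  have JZ: "J Z = - A"
    by (simp add: Z_def JJ)
  have ip_vals: "ip Z A = 0" "ip A Z = 0" "ip Z Z = a" "ip A A = a"
    using Jskew[of A A] ip_commute[of A "J A"] by (auto simp: Z_def herm a_def)
  have brA: "ip A (bracket x y) = 0" "ip (bracket x y) A = 0" for x y
    using \<theta>br ip_commute[of _ A] by (auto simp: A)
  have d\<omega>: "ip (bracket x y) (J z) + ip (bracket y z) (J x) + ip (bracket z x) (J y)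
      = ip A x * ip (J y) z + ip A y * ip (J z) x + ip A z * ip (J x) y" for x y z
    using d\<omega>'[of x y z] by (simp add: A Jskew[of "bracket _ _"])
  \<comment> \<open>Brackets are orthogonal to \<open>A\<close>, so the Koszul formula against
    \<open>A\<close> is just the symmetric part of \<open>ad A\<close>. A parallel Lee form makes it
    vanish.\<close>
  have adA_skew: "ip (bracket A x) y = - ip x (bracket A y)" for x y
  proof -
    have "ip A (nabla x y) = 0"
      by (simp add: A par)
    then have "ip (nabla x y) A = 0"
      by (simp add: ip_commute)
    then show ?thesis
      using koszul[of x y A] bracket_anticommute[of y A] by (simp add: brA ip_simps ip_commute[of x])
  qed
  \<comment> \<open>\<open>d\<omega>\<close> is compared at (A, y, z) and (A, J y, J z): the
    right-hand sides agree, integrability equates the terms with \<open>Z\<close> (fact 3), and only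
    terms with \<open>ad A\<close> are left.\<close>
  have adA_J: "bracket A (J y) = J (bracket A y)" for y
  proof (rule ip_eqI)
    fix z
    have 1: "ip (bracket A y) (J z) + ip (bracket y z) Z + ip (bracket z A) (J y)
      = a * ip (J y) z + ip A y * ip (J z) A + ip A z * ip Z y"
      using d\<omega>[of A y z] by (simp add: Z_def a_def)
    have 2: "- ip (bracket A (J y)) z + ip (bracket (J y) (J z)) Z - ip (bracket (J z) A) y
      = a * ip (J y) z + ip (J A) y * ip z A - ip (J A) z * ip A y"
      using d\<omega>[of A "J y" "J z"] Jskew[of A]
      by (simp add: Z_def a_def JJ ip_simps Jskew[of y] herm)
    have 3: "ip (bracket (J y) (J z)) Z = ip (bracket y z) Z"
    proof -
      have "bracket (J y) (J z) = bracket y z + J (bracket (J y) z + bracket y (J z))"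
        using nij[of y z] by (simp add: algebra_simps)
      then show ?thesis
        by (simp add: Z_def ip_simps herm brA)
    qed
    have 4: "ip (bracket z A) (J y) = ip (bracket A (J y)) z"
      using adA_skew[of "J y" z] bracket_anticommute[of z A] by (simp add: ip_simps ip_commute)
    have 5: "ip (bracket (J z) A) y = ip (bracket A y) (J z)"
      using adA_skew[of y "J z"] bracket_anticommute[of "J z" A] by (simp add: ip_simps ip_commute)
    have 6: "ip (J z) A = - ip (J A) z"
      using Jskew[of z A] by (simp add: ip_commute)
    have "ip (bracket A (J y)) z = - ip (bracket A y) (J z)"
      using 1 2 3 unfolding 4 5 6 Z_def by (simp add: ip_commute[of z A] algebra_simps)
    then show "ip (bracket A (J y)) z = ip (J (bracket A y)) z"
      by (simp add: Jskew)
  qed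
  have AZ: "bracket A Z = 0"
    by (simp add: Z_def adA_J bracket_self J_simps)
  \<comment> \<open>\<open>J\<close> sends \<open>A\<close> to \<open>Z\<close> and \<open>Z\<close>
    to \<open>- A\<close>; the corrections cancel this, \<open>a\<close> being the squared norm of
    both vectors.\<close>
  define \<phi> where "\<phi> x = J x - (ip A x / a) *\<^sub>R Z + (ip Z x / a) *\<^sub>R A" for x
  have lin\<phi>: "linear \<phi>"
    by (simp add: linear_iff \<phi>_def J_simps ip_simps algebra_simps add_divide_distrib)
  have \<phi>A: "\<phi> A = 0" and \<phi>Z: "\<phi> Z = 0"
    using a0 by (simp_all add: \<phi>_def ip_vals JZ) (simp add: Z_def)
  have ipJ: "ip A (J x) = - ip Z x" "ip Z (J x) = ip A x" for x
    using Jskew[of A x] by (auto simp: Z_def herm)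
  have \<phi>J: "\<phi> (J x) = J (\<phi> x)" for x
    by (simp add: \<phi>_def J_simps ipJ JZ) (simp add: Z_def)
  have JJ\<phi>: "\<phi> (\<phi> x) = J (\<phi> x)" for x
    by (subst (2) \<phi>_def) (simp add: linear_add[OF lin\<phi>] linear_diff[OF lin\<phi>] linear_cmul[OF lin\<phi>] \<phi>A \<phi>Z \<phi>J)
  have \<phi>_cube: "\<phi> (\<phi> (\<phi> x)) = - \<phi> x" for x
    by (simp add: JJ\<phi> \<phi>J JJ)
  have skew: "ip (\<phi> x) y = - ip x (\<phi> y)" for x y
    by (simp add: \<phi>_def ip_simps Jskew[of x] ip_commute[of _ A] ip_commute[of _ Z] mult.commute)
  \<comment> \<open>\<open>d\<omega>\<close> at (A, y, z), where the two terms with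
    \<open>ad A\<close> cancel. As \<open>Z\<close> has squared norm \<open>a\<close>, it can serve
    as the \<open>\<xi>\<close> of the locale without rescaling.\<close>
  have contact: "ip Z (bracket y z) = a * ip (\<phi> y) z" for y z
  proof -
    have "ip (bracket A y) (J z) + ip (bracket y z) Z + ip (bracket z A) (J y)
      = a * ip (J y) z + ip A y * ip (J z) A + ip A z * ip Z y"
      using d\<omega>[of A y z] by (simp add: Z_def a_def)
    moreover have "ip (bracket z A) (J y) = - ip (bracket A y) (J z)"
    proof -
      have "ip (bracket z A) (J y) = - ip (bracket A z) (J y)"
        using bracket_anticommute[of z A] by (simp add: ip_simps)
      also have "\<dots> = ip z (J (bracket A y))"
        by (simp add: adA_skew adA_J)
      finally show ?thesis
        using Jskew[of "bracket A y" z] by (simp add: ip_commute[of z])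
    qed
    ultimately show ?thesis
      using a0 ipJ[of z] by (simp add: \<phi>_def ip_simps ip_commute[of _ Z] ip_commute[of _ A] algebra_simps)
  qed
  have \<phi>br: "\<phi> (bracket x y) = J (bracket x y) + ip (\<phi> x) y *\<^sub>R A" for x y
    using a0 by (simp add: \<phi>_def[of "bracket x y"] brA contact)
  have split: "bracket x y = ip (\<phi> x) y *\<^sub>R Z - \<phi> (\<phi> (bracket x y))" for x y
    by (simp add: \<phi>br \<phi>J \<phi>A linear_add[OF lin\<phi>] linear_cmul[OF lin\<phi>] J_simps JJ Z_def)
  have integrable: "\<phi> (\<phi> (bracket (\<phi> x) (\<phi> y) - bracket x y))
      + \<phi> (bracket (\<phi> x) y + bracket x (\<phi> y)) = 0" for x y
  proof -
    \<comment> \<open>The difference takes values in the span of \<open>A\<close> and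
      \<open>Z\<close>. These commute with each other and their adjoint maps commute with
      \<open>J\<close>, so integrability of \<open>J\<close> passes to
      \<open>\<phi>\<close>.\<close>
    define r where "r x = \<phi> x - J x" for x
    have \<phi>r: "\<phi> x = J x + r x" for x
      by (simp add: r_def)
    have r: "r x = (ip Z x / a) *\<^sub>R A - (ip A x / a) *\<^sub>R Z" for x
      by (simp add: r_def \<phi>_def)
    have adZ_J: "bracket Z (J y) = J (bracket Z y)" for y
      using nij[of A y] by (simp add: adA_J JJ J_simps flip: Z_def)
    have r1: "bracket (r x) (J y) = J (bracket (r x) y)" for x y
      by (simp add: r bracket_simps adA_J adZ_J J_simps)
    have r2: "bracket (J x) (r y) = J (bracket x (r y))" for x y
      using r1[of y x] bracket_anticommute[of "J x" "r y"] bracket_anticommute[of x "r y"]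
      by (simp add: J_simps)
    have r3: "bracket (r x) (r y) = 0" for x y
      using AZ bracket_anticommute[of Z A] by (simp add: r bracket_simps bracket_self)
    define U where "U = bracket (\<phi> x) y + bracket x (\<phi> y)"
    have "bracket (\<phi> x) (\<phi> y) = bracket (J x) (J y) + J (bracket x (r y)) + J (bracket (r x) y)"
      unfolding \<phi>r by (simp add: bracket_simps r1 r2 r3)
    also have "bracket (J x) (J y) = bracket x y + J (bracket (J x) y + bracket x (J y))"
      using nij[of x y] by (simp add: algebra_simps)
    finally have "bracket (\<phi> x) (\<phi> y) - bracket x y = J U"
      unfolding U_def \<phi>r by (simp add: bracket_simps J_simps)
    then show ?thesis
      by (simp add: JJ\<phi> \<phi>J JJ flip: U_def)
  qed
  have "transverse_kaehler bracket ip \<phi> Z"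
  proof unfold_locales
    show "bracket x y = ip (\<phi> x) y *\<^sub>R Z - \<phi> (\<phi> (bracket x y))" for x y
      by (rule split)
    show "Z \<noteq> 0"
      using a0 ip_vals(3) by (auto simp: ip_simps)
  qed (use skew \<phi>_cube \<phi>Z integrable assms(2,3) in
      \<open>simp_all add: linear_add[OF lin\<phi>] linear_cmul[OF lin\<phi>]\<close>)
  then show ?thesis by blast
qed

theorem corollary7p4:
  fixes bracket :: "'a::real_vector \<Rightarrow> 'a \<Rightarrow> 'a"
  assumes "fd_lie_algebra bracket"
    and "unimodular bracket"
    and "solvable_lie bracket"
  shows "((\<exists>J ip. vaisman_structure bracket J ip) \<longrightarrow>
            (\<exists>prd. lsa_structure bracket prd \<and> complete_lsa prd)) \<and>
         ((\<exists>ip \<phi> \<xi> \<eta>. sasakian_structure bracket ip \<phi> \<xi> \<eta>) \<longrightarrow>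
            (\<exists>prd. lsa_structure bracket prd \<and> complete_lsa prd))"
  using vaisman_transverse_kaehler[OF assms] sasakian_transverse_kaehler[OF assms]
    transverse_kaehler.complete_lsa_exists by blast

end
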